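(* A matroid $\mathsf{M}$ of rank $k$ and size $n$ is elementary split if and only if after relaxing all the stressed subsets of $\mathsf{M}$ one obtains the uniform matroid $\mathsf{U}_{k,n}$.
   Context: $\mathsf{U}_{k,n}$ denotes the uniform matroid of rank $k$ on $n$ elements (up to isomorphism). Let $\mathsf{M}$ be a matroid on $E$ of rank $k$ with rank function $\operatorname{rk}$ and set of bases $\mathscr{B}$. Stressed subsets and relaxation: a subset $A\subseteq E$ is stressed if both $\mathsf{M}|_A$ and $\mathsf{M}/A$ are uniform matroids. The cover of $A$ is $\operatorname{cover}(A)=\{S\subseteq E: |S|=k,\ |S\cap A|\ge \operatorname{rk}(A)+1\}$. If $A$ is stressed, the relaxation $\operatorname{Rel}(\mathsf{M},A)$ is the matroid on $E$ with set of bases $\mathscr{B}\sqcup\operatorname{cover}(A)$. Relaxing a stressed subset with empty cover does not change the matroid. "Relaxing all the stressed subsets of $\mathsf{M}$" means: if $F_1,\dots,F_m$ are the stressed subsets of $\mathsf{M}$ with non-empty cover, one relaxes them one after another, $\mathsf{M}_0=\mathsf{M}$, $\mathsf{M}_i=\operatorname{Rel}(\mathsf{M}_{i-1},F_i)$, and considers the resulting matroid $\mathsf{M}_m$, whose set of bases is $\mathscr{B}\cup\bigcup_{i}\operatorname{cover}_{\mathsf{M}}(F_i)$. Elementary split matroids: a matroid is connected if it is not a direct sum of two matroids with non-empty ground sets. For a connected matroid $\mathsf{M}$ on $E$, a flacet is a flat $F$ such that $\mathsf{M}|_F$ and $\mathsf{M}/F$ are connected; a flacet $F$ is a split flacet if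 $0<\operatorname{rk}(F)<|F|$ and $E\smallsetminus F$ contains at least one element that is not a coloop of $\mathsf{M}$. A connected split matroid is a connected matroid all of whose split flacets are stressed. A matroid is elementary split if it is either a connected split matroid or a direct sum of two uniform matroids. *)

theory Defs
  imports Main
begin

record 'a matroid_data =
  ground :: "'a set"
  bases :: "'a set set"

locale matroid =
  fixes M :: "'a matroid_data"
  assumes finite_ground: "finite (ground M)"
    and bases_subset: "B \<in> bases M \<Longrightarrow> B \<subseteq> ground M"
    and bases_nonempty: "bases M \<noteq> {}"
    and bases_exchange: "\<lbrakk>B \<in> bases M; B' \<in> bases M; x \<in> B - B'\<rbrakk> \<Longrightarrow>
          \<exists>y \<in> B' - B. insert y (B - {x}) \<in> bases M"

definition indep :: "'a matroid_data \<Rightarrow> 'a set \<Rightarrow> bool" where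
  "indep M I \<longleftrightarrow> (\<exists>B \<in> bases M. I \<subseteq> B)"

definition rk :: "'a matroid_data \<Rightarrow> 'a set \<Rightarrow> nat" where
  "rk M A = Max {card I | I. indep M I \<and> I \<subseteq> A}"

abbreviation rank :: "'a matroid_data \<Rightarrow> nat" where
  "rank M \<equiv> rk M (ground M)"

definition restriction :: "'a matroid_data \<Rightarrow> 'a set \<Rightarrow> 'a matroid_data" where
  "restriction M A =
     \<lparr>ground = A,
      bases = {I. indep M I \<and> I \<subseteq> A \<and> (\<forall>J. indep M J \<and> J \<subseteq> A \<and> I \<subseteq> J \<longrightarrow> J = I)}\<rparr>"

text \<open>In a matroid, whether \<open>I \<union> J\<close> below is a basis does not depend on the choice of the
  basis \<open>I\<close> of the restriction to \<open>A\<close>.\<close>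

definition contraction :: "'a matroid_data \<Rightarrow> 'a set \<Rightarrow> 'a matroid_data" where
  "contraction M A =
     \<lparr>ground = ground M - A,
      bases = {J. J \<subseteq> ground M - A \<and> (\<exists>I \<in> bases (restriction M A). I \<union> J \<in> bases M)}\<rparr>"

text \<open>Meant for matroids with disjoint ground sets.\<close>

definition direct_sum :: "'a matroid_data \<Rightarrow> 'a matroid_data \<Rightarrow> 'a matroid_data" where
  "direct_sum M N =
     \<lparr>ground = ground M \<union> ground N,
      bases = {B \<union> B' | B B'. B \<in> bases M \<and> B' \<in> bases N}\<rparr>"

text \<open>\<open>uniform_matroid k n M\<close> says that \<open>M\<close> is a copy of $\mathsf{U}_{k,n}$.  The ground set
  is arbitrary, as $\mathsf{U}_{k,n}$ is only determined up to isomorphism.\<close>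

definition uniform_matroid :: "nat \<Rightarrow> nat \<Rightarrow> 'a matroid_data \<Rightarrow> bool" where
  "uniform_matroid k n M \<longleftrightarrow>
     finite (ground M) \<and> card (ground M) = n \<and> k \<le> n \<and>
     bases M = {S. S \<subseteq> ground M \<and> card S = k}"

definition is_uniform :: "'a matroid_data \<Rightarrow> bool" where
  "is_uniform M \<longleftrightarrow> (\<exists>k n. uniform_matroid k n M)"

definition stressed :: "'a matroid_data \<Rightarrow> 'a set \<Rightarrow> bool" where
  "stressed M A \<longleftrightarrow>
     A \<subseteq> ground M \<and> is_uniform (restriction M A) \<and> is_uniform (contraction M A)"

definition cover :: "'a matroid_data \<Rightarrow> 'a set \<Rightarrow> 'a set set" where
  "cover M A = {S. S \<subseteq> ground M \<and> card S = rank M \<and> card (S \<inter> A) \<ge> rk M A + 1}"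

text \<open>Meant for stressed \<open>A\<close>; only then is the result guaranteed to be a matroid.\<close>

definition relaxation :: "'a matroid_data \<Rightarrow> 'a set \<Rightarrow> 'a matroid_data" where
  "relaxation M A = \<lparr>ground = ground M, bases = bases M \<union> cover M A\<rparr>"

text \<open>One relaxation after another, each one (including its cover) being formed in the
  matroid produced by the previous step.\<close>

definition relax_list :: "'a matroid_data \<Rightarrow> 'a set list \<Rightarrow> 'a matroid_data" where
  "relax_list M Fs = foldl relaxation M Fs"

definition flat :: "'a matroid_data \<Rightarrow> 'a set \<Rightarrow> bool" where
  "flat M F \<longleftrightarrow> F \<subseteq> ground M \<and> (\<forall>e \<in> ground M - F. rk M F < rk M (insert e F))"

definition coloop :: "'a matroid_data \<Rightarrow> 'a \<Rightarrow> bool" where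
  "coloop M e \<longleftrightarrow> e \<in> ground M \<and> (\<forall>B \<in> bases M. e \<in> B)"

text \<open>The matroid on the empty set counts as connected.\<close>

definition connected :: "'a matroid_data \<Rightarrow> bool" where
  "connected M \<longleftrightarrow>
     \<not> (\<exists>M1 M2. matroid M1 \<and> matroid M2 \<and> ground M1 \<inter> ground M2 = {} \<and>
          ground M1 \<noteq> {} \<and> ground M2 \<noteq> {} \<and> M = direct_sum M1 M2)"

definition flacet :: "'a matroid_data \<Rightarrow> 'a set \<Rightarrow> bool" where
  "flacet M F \<longleftrightarrow> flat M F \<and> connected (restriction M F) \<and> connected (contraction M F)"

definition split_flacet :: "'a matroid_data \<Rightarrow> 'a set \<Rightarrow> bool" where
  "split_flacet M F \<longleftrightarrow>
     flacet M F \<and> 0 < rk M F \<and> rk M F < card F \<and> (\<exists>e \<in> ground M - F. \<not> coloop M e)"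

definition connected_split :: "'a matroid_data \<Rightarrow> bool" where
  "connected_split M \<longleftrightarrow> connected M \<and> (\<forall>F. split_flacet M F \<longrightarrow> stressed M F)"

definition elementary_split :: "'a matroid_data \<Rightarrow> bool" where
  "elementary_split M \<longleftrightarrow>
     connected_split M \<or>
     (\<exists>M1 M2. is_uniform M1 \<and> is_uniform M2 \<and> ground M1 \<inter> ground M2 = {} \<and>
        M = direct_sum M1 M2)"

end

theory Submission
  imports Defs
begin

text \<open>Covers of distinct stressed sets are disjoint, so the successive relaxations do not interfere
  and their result is uniform iff every nonbasis \<open>S\<close> of size \<open>k\<close> lies in the cover of a stressed set.

  Call a flat cyclic if its restriction has no coloops.  Submodularity shows that a set \<open>S\<close> in the
  cover of a stressed set \<open>A\<close> satisfies \<open>card (S \<inter> F) > rk F\<close> for no cyclic flat \<open>F\<close> other than \<open>A\<close>.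
  Hence, if the relaxation is uniform, every dependent proper cyclic flat is stressed: in a connected
  matroid this applies to all split flacets, and a disconnected matroid has a stressed separator or
  is itself uniform.

  Conversely, in a connected matroid each nonbasis \<open>S\<close> of size \<open>k\<close> violates the rank bound of some
  split flacet \<open>F\<close>, so \<open>S\<close> lies in the cover of \<open>F\<close>.\<close>

section \<open>Independence and rank\<close>

context matroid
begin

lemma finite_subset_ground: "A \<subseteq> ground M \<Longrightarrow> finite A"
  using finite_ground finite_subset by blast

lemma finite_basis: "B \<in> bases M \<Longrightarrow> finite B"
  using bases_subset finite_ground finite_subset by blast

text \<open>Exchanging an element of \<open>B - B'\<close> for one of \<open>B' - B\<close> keeps
  the size and shrinks the difference, so the induction ends at a basis contained in
  \<open>B'\<close>.\<close>

lemma card_bases_le: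
  assumes "B \<in> bases M" "B' \<in> bases M"
  shows "card B \<le> card B'"
  using assms(1)
proof (induction "card (B - B')" arbitrary: B rule: less_induct)
  case less
  show ?case
  proof (cases "B \<subseteq> B'")
    case True
    then show ?thesis using finite_basis[OF assms(2)] card_mono by blast
  next
    case False
    then obtain x where x: "x \<in> B - B'" by blast
    obtain y where y: "y \<in> B' - B" "insert y (B - {x}) \<in> bases M"
      using bases_exchange[OF less.prems assms(2) x] by blast
    have fin: "finite B" using finite_basis less.prems by blast
    have "insert y (B - {x}) - B' \<subset> B - B'" using x y by auto
    then have "card (insert y (B - {x}) - B') < card (B - B')"
      using fin by (meson finite_Diff psubset_card_mono)
    from less.hyps[OF this y(2)] have "card (insert y (B - {x})) \<le> card B'" .
    moreover have "card (insert y (B - {x})) = card B"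
      using x y fin card_Suc_Diff1[OF fin, of x] by simp
    ultimately show ?thesis by simp
  qed
qed

lemma card_bases_eq: "B \<in> bases M \<Longrightarrow> B' \<in> bases M \<Longrightarrow> card B = card B'"
  by (simp add: card_bases_le le_antisym)

lemma indep_subset: "indep M J \<Longrightarrow> I \<subseteq> J \<Longrightarrow> indep M I"
  unfolding indep_def by blast

lemma indep_ground: "indep M I \<Longrightarrow> I \<subseteq> ground M"
  unfolding indep_def using bases_subset by blast

lemma indep_finite: "indep M I \<Longrightarrow> finite I"
  using indep_ground finite_ground finite_subset by blast

lemma indep_empty: "indep M {}"
  unfolding indep_def using bases_nonempty by blast

text \<open>Let \<open>B'\<close> be a basis containing \<open>J\<close>. A basis containing
  \<open>I\<close> with the fewest elements outside \<open>I \<union> B'\<close> has none there,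
  since an exchange with \<open>B'\<close> would remove one. Counting then forces it to contain an
  element of \<open>J - I\<close>.\<close>

lemma indep_augment:
  assumes I: "indep M I" and J: "indep M J" and less: "card I < card J"
  shows "\<exists>y \<in> J - I. indep M (insert y I)"
proof -
  obtain B' where B': "B' \<in> bases M" "J \<subseteq> B'" using J unfolding indep_def by blast
  define P where "P B \<longleftrightarrow> B \<in> bases M \<and> I \<subseteq> B" for B
  obtain B0 where "P B0" using I unfolding indep_def P_def by blast
  then obtain B where PB: "P B" and min: "\<And>C. P C \<Longrightarrow> card (B - (I \<union> B')) \<le> card (C - (I \<union> B'))"
    using ex_has_least_nat[of P B0 "\<lambda>B. card (B - (I \<union> B'))"] by blast
  have B: "B \<in> bases M" "I \<subseteq> B" using PB P_def by auto
  have fin: "finite B" "finite B'" "finite I" "finite J"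
    using finite_basis B B' finite_subset by metis+
  have sub: "B \<subseteq> I \<union> B'"
  proof (rule ccontr)
    assume "\<not> ?thesis"
    then obtain x where x: "x \<in> B" "x \<notin> I" "x \<notin> B'" by blast
    then obtain y where y: "y \<in> B' - B" "insert y (B - {x}) \<in> bases M"
      using bases_exchange[OF B(1) B'(1)] by blast
    have "P (insert y (B - {x}))" using y B x unfolding P_def by blast
    moreover have "insert y (B - {x}) - (I \<union> B') \<subset> B - (I \<union> B')" using x y by auto
    then have "card (insert y (B - {x}) - (I \<union> B')) < card (B - (I \<union> B'))"
      using fin by (meson finite_Diff psubset_card_mono)
    ultimately show False using min by fastforce
  qed
  have "\<not> B \<inter> J \<subseteq> I"
  proof
    assume "B \<inter> J \<subseteq> I"
    then have "B \<subseteq> I \<union> (B' - J)" using sub by blast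
    then have "card B \<le> card I + card (B' - J)"
      using fin by (meson card_Un_le card_mono finite_Diff finite_UnI le_trans)
    also have "\<dots> = card I + (card B' - card J)"
      using B'(2) fin by (simp add: card_Diff_subset)
    also have "\<dots> < card B'" using less card_mono[OF fin(2) B'(2)] by linarith
    finally show False using card_bases_eq[OF B(1) B'(1)] by simp
  qed
  then obtain y where "y \<in> B" "y \<in> J" "y \<notin> I" by blast
  then show ?thesis using B unfolding indep_def by blast
qed

lemma finite_rk_set: "finite {card I | I. indep M I \<and> I \<subseteq> A}"
proof (rule finite_subset)
  show "{card I | I. indep M I \<and> I \<subseteq> A} \<subseteq> card ` Pow (ground M)"
    using indep_ground by blast
qed (use finite_ground in simp)

lemma card_le_rk: "indep M I \<Longrightarrow> I \<subseteq> A \<Longrightarrow> card I \<le> rk M A"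
  unfolding rk_def using finite_rk_set[of A] by (intro Max_ge) auto

lemma rk_obtain:
  obtains I where "indep M I" "I \<subseteq> A" "card I = rk M A"
proof -
  have "rk M A \<in> {card I | I. indep M I \<and> I \<subseteq> A}"
    unfolding rk_def using finite_rk_set[of A] indep_empty by (intro Max_in) auto
  then show thesis using that by auto
qed

lemma rk_mono: "A \<subseteq> B \<Longrightarrow> rk M A \<le> rk M B"
  by (metis rk_obtain card_le_rk subset_trans)

lemma rk_le_card: "finite A \<Longrightarrow> rk M A \<le> card A"
  by (metis rk_obtain card_mono)

lemma rk_indep: "indep M I \<Longrightarrow> rk M I = card I"
  by (simp add: card_le_rk indep_finite le_antisym rk_le_card)

lemma indep_iff_rk: "finite I \<Longrightarrow> indep M I \<longleftrightarrow> rk M I = card I"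
  by (metis card_subset_eq rk_indep rk_obtain)

lemma rk_empty: "rk M {} = 0"
  using rk_le_card[of "{}"] by simp

lemma basis_iff: "B \<in> bases M \<longleftrightarrow> indep M B \<and> card B = rank M"
proof -
  have base: "card B = rank M" if "B \<in> bases M" for B
  proof -
    have "indep M B" using that unfolding indep_def by blast
    then have "card B \<le> rank M" using card_le_rk indep_ground by blast
    moreover obtain I B' where I: "card I = rank M" "B' \<in> bases M" "I \<subseteq> B'"
      by (metis rk_obtain indep_def)
    then have "rank M \<le> card B'" by (metis card_mono finite_basis)
    ultimately show ?thesis using card_bases_eq[OF that I(2)] by linarith
  qed
  show ?thesis
  proof
    assume "B \<in> bases M"
    then show "indep M B \<and> card B = rank M" using base unfolding indep_def by blast
  next
    assume a: "indep M B \<and> card B = rank M"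
    then obtain B' where "B' \<in> bases M" "B \<subseteq> B'" unfolding indep_def by blast
    then show "B \<in> bases M" using a base card_subset_eq finite_basis by metis
  qed
qed

lemma indep_extend:
  assumes "indep M I" "I \<subseteq> A"
  obtains J where "indep M J" "I \<subseteq> J" "J \<subseteq> A" "card J = rk M A"
proof -
  have "\<exists>J. indep M J \<and> I \<subseteq> J \<and> J \<subseteq> A \<and> card J = rk M A"
    using assms
  proof (induction "rk M A - card I" arbitrary: I rule: less_induct)
    case less
    show ?case
    proof (cases "card I = rk M A")
      case False
      then have l: "card I < rk M A" using card_le_rk[OF less.prems] by simp
      obtain K where K: "indep M K" "K \<subseteq> A" "card K = rk M A" by (rule rk_obtain)
      then obtain y where y: "y \<in> K - I" "indep M (insert y I)"
        using indep_augment[OF less.prems(1) K(1)] l by auto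
      have "card (insert y I) = Suc (card I)"
        using y indep_finite[OF less.prems(1)] by simp
      then have "\<exists>J. indep M J \<and> insert y I \<subseteq> J \<and> J \<subseteq> A \<and> card J = rk M A"
        using less.hyps[of "insert y I"] y K(2) less.prems(2) l by auto
      then show ?thesis by blast
    qed (use less.prems in blast)
  qed
  then show thesis using that by blast
qed

text \<open>Extend a largest independent subset \<open>I\<close> of \<open>A \<inter> B\<close> to a
  largest independent subset \<open>J\<close> of \<open>A \<union> B\<close>. The traces of
  \<open>J\<close> on \<open>A\<close> and \<open>B\<close> are independent, cover \<open>J\<close>,
  and both contain \<open>I\<close>.\<close>

lemma rk_submodular: "rk M (A \<union> B) + rk M (A \<inter> B) \<le> rk M A + rk M B"
proof -
  obtain I where I: "indep M I" "I \<subseteq> A \<inter> B" "card I = rk M (A \<inter> B)" by (rule rk_obtain)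
  have IAB: "I \<subseteq> A \<union> B" using I(2) by blast
  obtain J where J: "indep M J" "I \<subseteq> J" "J \<subseteq> A \<union> B" "card J = rk M (A \<union> B)"
    by (rule indep_extend[OF I(1) IAB])
  have fin: "finite J" using J(1) indep_finite by blast
  have le: "card (J \<inter> A) \<le> rk M A" "card (J \<inter> B) \<le> rk M B"
    by (rule card_le_rk[OF indep_subset[OF J(1)]]; simp)+
  have "card J + card I \<le> card (J \<inter> A \<union> J \<inter> B) + card (J \<inter> A \<inter> (J \<inter> B))"
    using J(2,3) I(2) fin by (intro add_mono card_mono) auto
  also have "\<dots> = card (J \<inter> A) + card (J \<inter> B)"
    using fin by (intro card_Un_Int[symmetric]) auto
  finally show ?thesis using I(3) J(4) le by linarith
qed

lemma rk_Un_le: "rk M (A \<union> B) \<le> rk M A + rk M B"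
  using rk_submodular[of A B] by linarith

text \<open>Submodularity for \<open>A\<close> and \<open>I \<union> X\<close>, whose intersection
  contains \<open>I\<close> and so already has the rank of \<open>A\<close>.\<close>

lemma rk_Un_spanning:
  assumes "I \<subseteq> A" "rk M I = rk M A"
  shows "rk M (I \<union> X) = rk M (A \<union> X)"
proof (rule antisym)
  show "rk M (I \<union> X) \<le> rk M (A \<union> X)" using assms(1) by (intro rk_mono) auto
  have "rk M (A \<union> (I \<union> X)) + rk M (A \<inter> (I \<union> X)) \<le> rk M A + rk M (I \<union> X)"
    by (rule rk_submodular)
  moreover have "A \<union> (I \<union> X) = A \<union> X" using assms(1) by blast
  moreover have "rk M I \<le> rk M (A \<inter> (I \<union> X))" using assms(1) by (intro rk_mono) auto
  ultimately show "rk M (A \<union> X) \<le> rk M (I \<union> X)" using assms(2) by simp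
qed

section \<open>Minors, direct sums and connectedness\<close>

text \<open>Every independent subset of \<open>A\<close> extends to one of size
  \<open>rk M A\<close>, so maximality under inclusion agrees with maximality in size.\<close>

lemma basis_restriction_iff:
  "I \<in> bases (restriction M A) \<longleftrightarrow> indep M I \<and> I \<subseteq> A \<and> card I = rk M A"
proof
  assume I: "I \<in> bases (restriction M A)"
  then have I': "indep M I" "I \<subseteq> A" by (auto simp: restriction_def)
  obtain J where J: "indep M J" "I \<subseteq> J" "J \<subseteq> A" "card J = rk M A"
    by (rule indep_extend[OF I'])
  then show "indep M I \<and> I \<subseteq> A \<and> card I = rk M A"
    using I by (auto simp: restriction_def)
next
  assume I: "indep M I \<and> I \<subseteq> A \<and> card I = rk M A"
  have "J = I" if "indep M J" "J \<subseteq> A" "I \<subseteq> J" for J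
  proof -
    have "card J \<le> card I" using that I card_le_rk by simp
    then show ?thesis using that indep_finite card_seteq by metis
  qed
  then show "I \<in> bases (restriction M A)" using I by (auto simp: restriction_def)
qed

lemma basis_restriction_obtain:
  obtains I where "I \<in> bases (restriction M A)"
  using rk_obtain[of A] basis_restriction_iff by metis

lemma ground_restriction [simp]: "ground (restriction M A) = A"
  by (simp add: restriction_def)

lemma ground_contraction [simp]: "ground (contraction M A) = ground M - A"
  by (simp add: contraction_def)

lemma indep_restriction: "indep (restriction M A) I \<longleftrightarrow> indep M I \<and> I \<subseteq> A"
  unfolding indep_def[of "restriction M A"] Bex_def basis_restriction_iff
  by (meson indep_extend indep_subset subset_trans)

lemma rk_restriction: "X \<subseteq> A \<Longrightarrow> rk (restriction M A) X = rk M X"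
  unfolding rk_def indep_restriction by (metis (no_types, lifting) subset_trans)

lemma matroid_restriction:
  assumes "A \<subseteq> ground M"
  shows "matroid (restriction M A)"
proof
  show "finite (ground (restriction M A))"
    using assms finite_ground finite_subset by simp blast
  show "B \<subseteq> ground (restriction M A)" if "B \<in> bases (restriction M A)" for B
    using that by (simp add: basis_restriction_iff)
  show "bases (restriction M A) \<noteq> {}"
    by (metis basis_restriction_obtain empty_iff)
  show "\<exists>y \<in> B' - B. insert y (B - {x}) \<in> bases (restriction M A)"
    if B: "B \<in> bases (restriction M A)" "B' \<in> bases (restriction M A)" "x \<in> B - B'" for B B' x
  proof -
    have *: "indep M B" "B \<subseteq> A" "card B = rk M A" "indep M B'" "B' \<subseteq> A" "card B' = rk M A"
      using B by (auto simp: basis_restriction_iff)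
    have fin: "finite B" using indep_finite * by blast
    have i: "indep M (B - {x})" using indep_subset[OF *(1)] by blast
    have c: "Suc (card (B - {x})) = card B" using B(3) by (intro card_Suc_Diff1[OF fin]) simp
    then have "card (B - {x}) < card B'" using * by simp
    then obtain y where y: "y \<in> B' - (B - {x})" "indep M (insert y (B - {x}))"
      using indep_augment[OF i *(4)] by blast
    have "y \<in> B' - B" using y B(3) by auto
    moreover have "card (insert y (B - {x})) = rk M A" using y c fin * by simp
    ultimately show ?thesis using y * unfolding basis_restriction_iff by blast
  qed
qed

text \<open>Since \<open>I\<close> spans \<open>A\<close>, the set \<open>I \<union> J\<close> has
  the rank of \<open>A \<union> J\<close>. The right-hand side does not mention \<open>I\<close>,
  which makes \<open>contraction\<close> independent of its choice.\<close>

lemma Un_basis_iff: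
  assumes "I \<in> bases (restriction M A)" "A \<subseteq> ground M" "J \<subseteq> ground M - A"
  shows "I \<union> J \<in> bases M \<longleftrightarrow> rk M A + card J = rank M \<and> rk M (A \<union> J) = rank M"
proof -
  have I: "indep M I" "I \<subseteq> A" "card I = rk M A"
    using assms(1) by (auto simp: basis_restriction_iff)
  have fin: "finite I" "finite J"
    using I indep_finite assms(3) finite_ground by (blast intro: finite_subset)+
  have "I \<inter> J = {}" using assms(3) I(2) by blast
  then have "card (I \<union> J) = rk M A + card J" using I fin by (simp add: card_Un_disjoint)
  moreover have "rk M (I \<union> J) = rk M (A \<union> J)" using rk_Un_spanning I rk_indep by simp
  ultimately show ?thesis using fin by (auto simp: basis_iff indep_iff_rk)
qed

lemma basis_contraction_iff:
  assumes "A \<subseteq> ground M"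
  shows "J \<in> bases (contraction M A) \<longleftrightarrow>
    J \<subseteq> ground M - A \<and> rk M A + card J = rank M \<and> rk M (A \<union> J) = rank M"
proof -
  have "\<exists>I. I \<in> bases (restriction M A)"
    by (metis basis_restriction_obtain)
  then show ?thesis using Un_basis_iff[OF _ assms]
    by (auto simp: contraction_def)
qed

text \<open>For one fixed basis \<open>I\<close> of the restriction, the bases of the contraction
  are the sets \<open>J\<close> outside \<open>A\<close> with \<open>I \<union> J\<close> in
  \<open>bases M\<close>. Exchanges between two such unions never touch \<open>I\<close>.\<close>

lemma matroid_contraction:
  assumes "A \<subseteq> ground M"
  shows "matroid (contraction M A)"
proof -
  obtain I where I: "I \<in> bases (restriction M A)"
    by (rule basis_restriction_obtain)
  then have I': "indep M I" "I \<subseteq> A" "card I = rk M A" by (auto simp: basis_restriction_iff)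
  have iff: "J \<in> bases (contraction M A) \<longleftrightarrow> J \<subseteq> ground M - A \<and> I \<union> J \<in> bases M" for J
    using Un_basis_iff[OF I assms] basis_contraction_iff[OF assms] by blast
  show ?thesis
  proof
    show "finite (ground (contraction M A))" using finite_ground by simp
    show "B \<subseteq> ground (contraction M A)" if "B \<in> bases (contraction M A)" for B
      using that iff by simp
    obtain B where B: "B \<in> bases M" "I \<subseteq> B" using I'(1) unfolding indep_def by blast
    have "indep M (B \<inter> A)" using B unfolding indep_def by blast
    then have "card (B \<inter> A) \<le> card I" using I' card_le_rk by simp
    then have "B \<inter> A = I"
      using B I'(2) finite_basis[OF B(1)] by (intro card_seteq[symmetric]) auto
    then have "I \<union> (B - A) = B" by blast
    then have "B - A \<in> bases (contraction M A)" using iff B bases_subset[OF B(1)] by auto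
    then show "bases (contraction M A) \<noteq> {}" by blast
    show "\<exists>y \<in> B' - B. insert y (B - {x}) \<in> bases (contraction M A)"
      if B: "B \<in> bases (contraction M A)" "B' \<in> bases (contraction M A)" "x \<in> B - B'" for B B' x
    proof -
      have x: "x \<notin> I" using B iff I'(2) by blast
      then obtain y where y: "y \<in> I \<union> B' - (I \<union> B)" "insert y (I \<union> B - {x}) \<in> bases M"
        using bases_exchange[of "I \<union> B" "I \<union> B'" x] B iff by blast
      moreover have "insert y (I \<union> B - {x}) = I \<union> insert y (B - {x})" using x by blast
      ultimately show ?thesis using B iff by (intro bexI[of _ y]) auto
    qed
  qed
qed

text \<open>For \<open>\<le>\<close>, completing \<open>J\<close> to a basis \<open>B\<close> of the
  contraction raises the rank of \<open>A \<union> J\<close> by at most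
  \<open>card B - card J\<close>. For \<open>\<ge>\<close>, extend a basis of \<open>A\<close> to
  one of \<open>A \<union> X\<close> and discard its part in \<open>A\<close>. The additive form
  avoids truncated subtraction.\<close>

lemma rk_contraction:
  assumes "A \<subseteq> ground M" "X \<subseteq> ground M - A"
  shows "rk (contraction M A) X + rk M A = rk M (A \<union> X)"
proof -
  interpret C: matroid "contraction M A" using matroid_contraction[OF assms(1)] .
  have fin: "finite Y" if "Y \<subseteq> ground M" for Y using that finite_ground finite_subset by blast
  show ?thesis
  proof (rule antisym)
    obtain J where J: "indep (contraction M A) J" "J \<subseteq> X" "card J = rk (contraction M A) X"
      by (rule C.rk_obtain)
    then obtain B where B: "J \<subseteq> B" "B \<in> bases (contraction M A)" unfolding indep_def by blast
    then have B': "B \<subseteq> ground M - A" "rk M A + card B = rank M" "rk M (A \<union> B) = rank M"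
      using basis_contraction_iff[OF assms(1)] by auto
    have finB: "finite B" using B'(1) fin by blast
    have "rk M (A \<union> B) \<le> rk M (A \<union> J) + rk M (B - J)"
      using rk_Un_le[of "A \<union> J" "B - J"] B(1) by (simp add: Un_assoc Un_absorb1)
    moreover have "rk M (B - J) \<le> card B - card J"
      using rk_le_card[of "B - J"] B(1) finB by (metis card_Diff_subset finite_Diff finite_subset)
    moreover have "card J \<le> card B" using B(1) finB card_mono by blast
    moreover have "rk M (A \<union> J) \<le> rk M (A \<union> X)" using J(2) by (intro rk_mono) auto
    ultimately show "rk (contraction M A) X + rk M A \<le> rk M (A \<union> X)" using B' J(3) by linarith
  next
    obtain I where I: "indep M I" "I \<subseteq> A" "card I = rk M A" by (rule rk_obtain)
    have IAX: "I \<subseteq> A \<union> X" using I(2) by blast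
    obtain K where K: "indep M K" "I \<subseteq> K" "K \<subseteq> A \<union> X" "card K = rk M (A \<union> X)"
      by (rule indep_extend[OF I(1) IAX])
    obtain B where B: "B \<in> bases M" "K \<subseteq> B" using K(1) unfolding indep_def by blast
    have "indep M (B \<inter> A)" using B unfolding indep_def by blast
    then have "card (B \<inter> A) \<le> card I" using I card_le_rk by simp
    then have BA: "B \<inter> A = I"
      using B I(2) K(2) finite_basis[OF B(1)] by (intro card_seteq[symmetric]) auto
    then have "I \<union> (B - A) = B" by blast
    then have "B - A \<in> bases (contraction M A)"
      using B bases_subset[OF B(1)] I
      by (auto simp: contraction_def basis_restriction_iff intro!: bexI[of _ I])
    then have "indep (contraction M A) (K - A)" using B unfolding indep_def by blast
    then have "card (K - A) \<le> rk (contraction M A) X" using K(3) by (intro C.card_le_rk) auto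
    moreover have "K = I \<union> (K - A)" using BA K(2) B by blast
    then have "card K \<le> card I + card (K - A)" by (metis card_Un_le)
    ultimately show "rk M (A \<union> X) \<le> rk (contraction M A) X + rk M A" using K I by linarith
  qed
qed

lemma card_basis: "B \<in> bases M \<Longrightarrow> card B = rank M"
  by (simp add: basis_iff)

section \<open>Direct sums as rank-additive partitions of the ground set\<close>

text \<open>A basis meets each side in at most the rank of that side, and the two bounds add up to
  its size, so both are attained. Conversely, bases of the two sides together span the ground set
  and have the right total size.\<close>

lemma separator_direct_sum:
  assumes "P \<subseteq> ground M" "rk M P + rk M (ground M - P) = rank M"
  shows "M = direct_sum (restriction M P) (restriction M (ground M - P))"
proof (rule matroid_data.equality)
  let ?Q = "ground M - P"
  have "B \<in> bases M \<longleftrightarrow> (\<exists>I J. B = I \<union> J \<and> I \<in> bases (restriction M P) \<and> J \<in> bases (restriction M ?Q))"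
    for B
  proof
    assume B: "B \<in> bases M"
    have i: "indep M B" "finite B" using B finite_basis by (auto simp: indep_def)
    have le: "card (B \<inter> P) \<le> rk M P" "card (B \<inter> ?Q) \<le> rk M ?Q"
      using indep_subset[OF i(1)] card_le_rk by (meson inf_le1 inf_le2)+
    have eq: "B = B \<inter> P \<union> B \<inter> ?Q" using bases_subset[OF B] by blast
    have "card (B \<inter> P \<union> B \<inter> ?Q) = card (B \<inter> P) + card (B \<inter> ?Q)"
      using i(2) by (intro card_Un_disjoint) auto
    then have "card (B \<inter> P) + card (B \<inter> ?Q) = rank M"
      using card_basis[OF B] eq[symmetric] by simp
    then have "card (B \<inter> P) = rk M P" "card (B \<inter> ?Q) = rk M ?Q"
      using le assms(2) by linarith+
    then have "B \<inter> P \<in> bases (restriction M P)" "B \<inter> ?Q \<in> bases (restriction M ?Q)"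
      using indep_subset[OF i(1)] by (auto simp: basis_restriction_iff)
    then show "\<exists>I J. B = I \<union> J \<and> I \<in> bases (restriction M P) \<and> J \<in> bases (restriction M ?Q)"
      using eq by blast
  next
    assume "\<exists>I J. B = I \<union> J \<and> I \<in> bases (restriction M P) \<and> J \<in> bases (restriction M ?Q)"
    then obtain I J where *: "B = I \<union> J" "indep M I" "I \<subseteq> P" "card I = rk M P"
      "indep M J" "J \<subseteq> ?Q" "card J = rk M ?Q"
      by (auto simp: basis_restriction_iff)
    have "rk M (I \<union> J) = rk M (P \<union> J)" using * rk_indep by (intro rk_Un_spanning) auto
    also have "\<dots> = rk M (J \<union> P)" by (simp add: Un_commute)
    also have "\<dots> = rk M (?Q \<union> P)" using * rk_indep by (intro rk_Un_spanning) auto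
    also have "?Q \<union> P = ground M" using assms(1) by blast
    finally have "rk M B = rank M" using *(1) by simp
    moreover have "card B = card I + card J"
      unfolding *(1) using * indep_finite by (intro card_Un_disjoint) auto
    moreover have "finite B" using * indep_finite by simp
    ultimately show "B \<in> bases M" using * assms(2) by (simp add: basis_iff indep_iff_rk)
  qed
  then show "bases M = bases (direct_sum (restriction M P) (restriction M ?Q))"
    by (intro set_eqI) (simp add: direct_sum_def)
  show "ground M = ground (direct_sum (restriction M P) (restriction M ?Q))"
    using assms(1) by (simp add: direct_sum_def Un_absorb1)
qed simp

end

lemma rk_direct_sum:
  assumes "matroid M1" "matroid M2" "ground M1 \<inter> ground M2 = {}" "X \<subseteq> ground M1"
  shows "rk (direct_sum M1 M2) X = rk M1 X"
proof -
  interpret M1: matroid M1 by (rule assms(1))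
  interpret M2: matroid M2 by (rule assms(2))
  have "indep (direct_sum M1 M2) I \<longleftrightarrow> indep M1 I" if I: "I \<subseteq> X" for I
  proof
    assume "indep (direct_sum M1 M2) I"
    then obtain B1 B2 where B: "I \<subseteq> B1 \<union> B2" "B1 \<in> bases M1" "B2 \<in> bases M2"
      unfolding indep_def direct_sum_def by auto
    then have "I \<subseteq> B1" using I M2.bases_subset[OF B(3)] assms(3,4) by blast
    then show "indep M1 I" using B(2) unfolding indep_def by blast
  next
    assume "indep M1 I"
    then obtain B1 where B1: "B1 \<in> bases M1" "I \<subseteq> B1" unfolding indep_def by blast
    obtain B2 where B2: "B2 \<in> bases M2" using M2.bases_nonempty by blast
    have "B1 \<union> B2 \<in> bases (direct_sum M1 M2)" using B1 B2 unfolding direct_sum_def by auto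
    then show "indep (direct_sum M1 M2) I" using B1(2) unfolding indep_def by blast
  qed
  then have "{card I | I. indep (direct_sum M1 M2) I \<and> I \<subseteq> X} = {card I | I. indep M1 I \<and> I \<subseteq> X}"
    by metis
  then show ?thesis unfolding rk_def by simp
qed

lemma direct_sum_commute: "direct_sum M1 M2 = direct_sum M2 M1"
  unfolding direct_sum_def by (auto simp: Un_commute)

context matroid
begin

text \<open>Converse of \<open>separator_direct_sum\<close>: a basis of the sum is a disjoint union
  of bases of the summands, and the rank of each ground set is the same in its summand and in
  \<open>M\<close>.\<close>

lemma direct_sum_separator:
  assumes "matroid M1" "matroid M2" "ground M1 \<inter> ground M2 = {}" "M = direct_sum M1 M2"
  shows "rk M (ground M1) + rk M (ground M - ground M1) = rank M"
proof -
  interpret M1: matroid M1 by (rule assms(1))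
  interpret M2: matroid M2 by (rule assms(2))
  have "ground M = ground M1 \<union> ground M2" using assms(4) by (simp add: direct_sum_def)
  then have g2: "ground M - ground M1 = ground M2" using assms(3) by blast
  have "rk M (ground M1) = Defs.rank M1"
    unfolding assms(4) by (rule rk_direct_sum[OF assms(1-3)]) simp
  moreover have "rk M (ground M2) = Defs.rank M2"
    unfolding assms(4) direct_sum_commute[of M1]
    by (rule rk_direct_sum[OF assms(2,1)]) (use assms(3) in auto)
  moreover obtain B1 B2 where B: "B1 \<in> bases M1" "B2 \<in> bases M2"
    using M1.bases_nonempty M2.bases_nonempty by blast
  have "B1 \<inter> B2 = {}" using M1.bases_subset[OF B(1)] M2.bases_subset[OF B(2)] assms(3) by blast
  then have "card (B1 \<union> B2) = Defs.rank M1 + Defs.rank M2"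
    using B M1.finite_basis M2.finite_basis M1.card_basis M2.card_basis by (simp add: card_Un_disjoint)
  moreover have "B1 \<union> B2 \<in> bases M" using B unfolding assms(4) direct_sum_def by auto
  then have "card (B1 \<union> B2) = rank M" by (rule card_basis)
  ultimately show ?thesis using g2 by simp
qed

text \<open>Combines the two translations between direct sums and rank-additive partitions, so that
  connectedness can be handled by submodularity.\<close>

lemma connected_iff:
  "connected M \<longleftrightarrow>
    (\<forall>P \<subseteq> ground M. rk M P + rk M (ground M - P) = rank M \<longrightarrow> P = {} \<or> P = ground M)"
proof
  assume c: "connected M"
  show "\<forall>P \<subseteq> ground M. rk M P + rk M (ground M - P) = rank M \<longrightarrow> P = {} \<or> P = ground M"
  proof (intro allI impI)
    fix P assume P: "P \<subseteq> ground M" "rk M P + rk M (ground M - P) = rank M"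
    show "P = {} \<or> P = ground M"
    proof (rule ccontr)
      let ?M1 = "restriction M P" and ?M2 = "restriction M (ground M - P)"
      assume "\<not> ?thesis"
      then have "ground ?M1 \<noteq> {}" "ground ?M2 \<noteq> {}" "ground ?M1 \<inter> ground ?M2 = {}"
        using P(1) by auto
      moreover have "matroid ?M1" "matroid ?M2"
        using P(1) by (auto intro: matroid_restriction)
      ultimately show False
        using c separator_direct_sum[OF P] unfolding connected_def by blast
    qed
  qed
next
  assume r: "\<forall>P \<subseteq> ground M. rk M P + rk M (ground M - P) = rank M \<longrightarrow> P = {} \<or> P = ground M"
  show "connected M" unfolding connected_def
  proof (rule notI, elim exE conjE)
    fix M1 M2 assume *: "matroid M1" "matroid M2" "ground M1 \<inter> ground M2 = {}"
      "ground M1 \<noteq> {}" "ground M2 \<noteq> {}" "M = direct_sum M1 M2"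
    have g: "ground M = ground M1 \<union> ground M2" using *(6) by (simp add: direct_sum_def)
    have "rk M (ground M1) + rk M (ground M - ground M1) = rank M"
      by (rule direct_sum_separator[OF *(1,2,3,6)])
    then have "ground M1 = {} \<or> ground M1 = ground M" using r g by blast
    then show False using *(3,4,5) g by blast
  qed
qed

lemma connected_restriction_iff:
  assumes "A \<subseteq> ground M"
  shows "connected (restriction M A) \<longleftrightarrow>
    (\<forall>P \<subseteq> A. rk M P + rk M (A - P) = rk M A \<longrightarrow> P = {} \<or> P = A)"
proof -
  interpret R: matroid "restriction M A" using matroid_restriction[OF assms] .
  show ?thesis unfolding R.connected_iff by (simp add: rk_restriction)
qed

text \<open>By \<open>rk_contraction\<close>, adding \<open>rk M A\<close> twice to the separator
  equation of the contraction turns all its ranks into ranks of \<open>M\<close> and leaves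
  \<open>rank M + rk M A\<close> on the right.\<close>

lemma connected_contraction_iff:
  assumes "A \<subseteq> ground M"
  shows "connected (contraction M A) \<longleftrightarrow>
    (\<forall>P \<subseteq> ground M - A. rk M (A \<union> P) + rk M (ground M - P) = rank M + rk M A \<longrightarrow>
       P = {} \<or> P = ground M - A)"
proof -
  interpret C: matroid "contraction M A" using matroid_contraction[OF assms] .
  have "rk (contraction M A) P + rk (contraction M A) (ground M - A - P) = Defs.rank (contraction M A) \<longleftrightarrow>
    rk M (A \<union> P) + rk M (ground M - P) = rank M + rk M A" if P: "P \<subseteq> ground M - A" for P
  proof -
    have "A \<union> (ground M - A - P) = ground M - P" "A \<union> (ground M - A) = ground M"
      using P assms by auto
    then have "rk (contraction M A) P + rk M A = rk M (A \<union> P)"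
      "rk (contraction M A) (ground M - A - P) + rk M A = rk M (ground M - P)"
      "Defs.rank (contraction M A) + rk M A = rank M"
      using rk_contraction[OF assms P] rk_contraction[OF assms, of "ground M - A - P"]
        rk_contraction[OF assms, of "ground M - A"] by auto
    then show ?thesis by linarith
  qed
  then show ?thesis unfolding C.connected_iff by simp
qed

section \<open>Uniform matroids and stressed sets through the rank function\<close>

text \<open>In a uniform matroid of rank \<open>k\<close>, a subset of \<open>X\<close> of size
  \<open>min (card X) k\<close> extends to a \<open>k\<close>-set, which is a basis. Conversely, the
  formula makes every set of size \<open>rank M\<close> independent.\<close>

lemma is_uniform_iff:
  "is_uniform M \<longleftrightarrow> (\<forall>X \<subseteq> ground M. rk M X = min (card X) (rank M))"
proof
  assume "is_uniform M"
  then obtain k where k: "k \<le> card (ground M)" "bases M = {S. S \<subseteq> ground M \<and> card S = k}"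
    unfolding is_uniform_def uniform_matroid_def by blast
  obtain B where B: "B \<in> bases M" using bases_nonempty by blast
  have rank: "rank M = k" using card_basis[OF B] B k(2) by simp
  show "\<forall>X \<subseteq> ground M. rk M X = min (card X) (rank M)"
  proof (intro allI impI)
    fix X assume X: "X \<subseteq> ground M"
    have finX: "finite X" using X finite_ground finite_subset by blast
    obtain I where I: "I \<subseteq> X" "card I = min (card X) k"
      by (meson finX min.cobounded1 obtain_subset_with_card_n)
    obtain S where S: "I \<subseteq> S" "S \<subseteq> ground M" "card S = k"
      using exists_subset_between[of I k "ground M"] I k(1) X finite_ground by auto
    then have "indep M I" using k(2) unfolding indep_def by blast
    then have "min (card X) k \<le> rk M X" using card_le_rk I by metis
    moreover have "rk M X \<le> card X" using rk_le_card finX by blast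
    moreover have "rk M X \<le> rank M" using X by (rule rk_mono)
    ultimately show "rk M X = min (card X) (rank M)" using rank by simp
  qed
next
  assume r: "\<forall>X \<subseteq> ground M. rk M X = min (card X) (rank M)"
  have "B \<in> bases M \<longleftrightarrow> B \<subseteq> ground M \<and> card B = rank M" for B
  proof
    assume "B \<in> bases M"
    then show "B \<subseteq> ground M \<and> card B = rank M" by (simp add: bases_subset card_basis)
  next
    assume B: "B \<subseteq> ground M \<and> card B = rank M"
    then have "finite B" using finite_ground finite_subset by blast
    moreover have "rk M B = card B" using r[rule_format, of B] B by simp
    ultimately show "B \<in> bases M" using B by (simp add: basis_iff indep_iff_rk)
  qed
  then have "bases M = {S. S \<subseteq> ground M \<and> card S = rank M}" by (intro set_eqI) simp
  moreover have "rank M \<le> card (ground M)" using rk_le_card finite_ground by blast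
  ultimately have "uniform_matroid (rank M) (card (ground M)) M"
    unfolding uniform_matroid_def using finite_ground by simp
  then show "is_uniform M" unfolding is_uniform_def by blast
qed

lemma is_uniform_restriction_iff:
  assumes "A \<subseteq> ground M"
  shows "is_uniform (restriction M A) \<longleftrightarrow> (\<forall>X \<subseteq> A. rk M X = min (card X) (rk M A))"
proof -
  interpret R: matroid "restriction M A" using matroid_restriction[OF assms] .
  show ?thesis unfolding R.is_uniform_iff by (simp add: rk_restriction)
qed

lemma is_uniform_contraction_iff:
  assumes "A \<subseteq> ground M"
  shows "is_uniform (contraction M A) \<longleftrightarrow>
    (\<forall>X \<subseteq> ground M - A. rk M (A \<union> X) = min (rk M A + card X) (rank M))"
proof -
  interpret C: matroid "contraction M A" using matroid_contraction[OF assms] .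
  have "rk (contraction M A) X = min (card X) (Defs.rank (contraction M A)) \<longleftrightarrow>
    rk M (A \<union> X) = min (rk M A + card X) (rank M)" if X: "X \<subseteq> ground M - A" for X
  proof -
    have "A \<union> (ground M - A) = ground M" using assms by auto
    then have "rk (contraction M A) X + rk M A = rk M (A \<union> X)"
      "Defs.rank (contraction M A) + rk M A = rank M"
      using rk_contraction[OF assms X] rk_contraction[OF assms, of "ground M - A"] by auto
    then show ?thesis by linarith
  qed
  then show ?thesis unfolding C.is_uniform_iff by simp
qed

lemma stressed_iff:
  "stressed M A \<longleftrightarrow> A \<subseteq> ground M \<and> (\<forall>X \<subseteq> A. rk M X = min (card X) (rk M A)) \<and>
    (\<forall>X \<subseteq> ground M - A. rk M (A \<union> X) = min (rk M A + card X) (rank M))"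
  unfolding stressed_def using is_uniform_restriction_iff is_uniform_contraction_iff by blast

section \<open>Separators and flats\<close>

text \<open>Submodularity for \<open>F \<union> Y\<close> and the complement of \<open>F\<close>,
  which meet in \<open>Y\<close> and together fill the ground set.\<close>

lemma rk_Un_disjoint_separator:
  assumes "F \<subseteq> ground M" "rk M F + rk M (ground M - F) = rank M" "Y \<subseteq> ground M - F"
  shows "rk M (F \<union> Y) = rk M F + rk M Y"
proof (rule antisym)
  have "(F \<union> Y) \<union> (ground M - F) = ground M" "(F \<union> Y) \<inter> (ground M - F) = Y"
    using assms(1,3) by auto
  then have "rank M + rk M Y \<le> rk M (F \<union> Y) + rk M (ground M - F)"
    using rk_submodular[of "F \<union> Y" "ground M - F"] by simp
  then show "rk M F + rk M Y \<le> rk M (F \<union> Y)" using assms(2) by linarith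
qed (rule rk_Un_le)

text \<open>Submodularity for \<open>P \<union> H\<close> and \<open>A - P\<close>, then for
  \<open>P\<close> and \<open>H\<close>; the rank of \<open>P \<union> H\<close> cancels. A
  separator thus induces one on each subset.\<close>

lemma separator_Int:
  assumes "P \<subseteq> A" "rk M P + rk M (A - P) = rk M A" "H \<subseteq> A"
  shows "rk M (P \<inter> H) + rk M (H - P) = rk M H"
proof (rule antisym)
  have "(P \<union> H) \<union> (A - P) = A" "(P \<union> H) \<inter> (A - P) = H - P" using assms(1,3) by auto
  then have "rk M A + rk M (H - P) \<le> rk M (P \<union> H) + rk M (A - P)"
    using rk_submodular[of "P \<union> H" "A - P"] by simp
  then show "rk M (P \<inter> H) + rk M (H - P) \<le> rk M H"
    using rk_submodular[of P H] assms(2) by linarith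
  have "P \<inter> H \<union> (H - P) = H" by blast
  then show "rk M H \<le> rk M (P \<inter> H) + rk M (H - P)"
    using rk_Un_le[of "P \<inter> H" "H - P"] by simp
qed

text \<open>Since \<open>X\<close> spans \<open>A\<close>, adding \<open>A\<close> to a flat that
  contains \<open>X\<close> cannot raise the rank, whereas an element of \<open>A\<close> outside
  the flat would.\<close>

lemma flat_spanned_subset:
  assumes "flat M F" "X \<subseteq> F" "X \<subseteq> A" "rk M X = rk M A" "A \<subseteq> ground M"
  shows "A \<subseteq> F"
proof (rule ccontr)
  assume "\<not> A \<subseteq> F"
  then obtain e where e: "e \<in> A" "e \<notin> F" by blast
  have "rk M (insert e F) \<le> rk M (A \<union> F)" using e by (intro rk_mono) auto
  also have "\<dots> = rk M (X \<union> F)" using rk_Un_spanning[OF assms(3,4)] by simp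
  also have "X \<union> F = F" using assms(2) by blast
  finally show False using assms(1,5) e unfolding flat_def by force
qed

end

section \<open>Cyclic flats and relaxation\<close>

text \<open>The second condition says that the restriction of \<open>M\<close> to \<open>F\<close> has no coloops.\<close>

definition cyclic_flat :: "'a matroid_data \<Rightarrow> 'a set \<Rightarrow> bool" where
  "cyclic_flat M F \<longleftrightarrow>
     flat M F \<and> (\<forall>X \<subseteq> F. rk M X + card (F - X) \<le> rk M F \<longrightarrow> X = F)"

context matroid
begin

text \<open>A set in the cover forces \<open>rk M A\<close> below both \<open>rank M\<close> and
  \<open>card A\<close>. By the first bound the uniform contraction has no loops, by the second the
  uniform restriction has no coloops.\<close>

lemma stressed_cyclic_flat:
  assumes "stressed M A" "S \<in> cover M A"
  shows "cyclic_flat M A"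
proof -
  have A: "A \<subseteq> ground M" and sub: "\<And>X. X \<subseteq> A \<Longrightarrow> rk M X = min (card X) (rk M A)"
    and quot: "\<And>X. X \<subseteq> ground M - A \<Longrightarrow> rk M (A \<union> X) = min (rk M A + card X) (rank M)"
    using assms(1) unfolding stressed_iff by blast+
  have S: "S \<subseteq> ground M" "card S = rank M" "rk M A < card (S \<inter> A)"
    using assms(2) unfolding cover_def by auto
  have fin: "finite A" "finite S" by (simp_all add: finite_subset_ground A S(1))
  have "card (S \<inter> A) \<le> card S" "card (S \<inter> A) \<le> card A" using fin by (auto intro: card_mono)
  then have less: "rk M A < rank M" "rk M A < card A" using S by linarith+
  have "rk M A < rk M (insert e A)" if "e \<in> ground M - A" for e
    using quot[of "{e}"] that less by simp
  then have "flat M A" unfolding flat_def using A by blast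
  moreover have "X = A" if X: "X \<subseteq> A" "rk M X + card (A - X) \<le> rk M A" for X
  proof -
    have "card X + card (A - X) = card A"
      using X(1) fin by (metis card_Diff_subset card_mono finite_subset le_add_diff_inverse)
    then have "card (A - X) = 0" using X(2) sub[OF X(1)] less(2) by linarith
    then show ?thesis using X(1) fin by auto
  qed
  ultimately show ?thesis unfolding cyclic_flat_def by blast
qed

text \<open>If \<open>A\<close> and \<open>F\<close> span together, counting in \<open>S\<close>
  makes \<open>A \<inter> F\<close> dependent, so it spans \<open>A\<close>; then \<open>F\<close>
  itself is spanning, which is impossible. Otherwise the uniform contraction makes the elements of
  \<open>F - A\<close> coloops of the restriction to \<open>F\<close>, so \<open>F\<close> lies in
  \<open>A\<close>, spans it and equals it.\<close>

lemma cover_cyclic_flat_eq: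
  assumes A: "stressed M A" "S \<in> cover M A" and F: "cyclic_flat M F" "rk M F < card (S \<inter> F)"
  shows "A = F"
proof -
  have AE: "A \<subseteq> ground M" and sub: "\<And>X. X \<subseteq> A \<Longrightarrow> rk M X = min (card X) (rk M A)"
    and quot: "\<And>X. X \<subseteq> ground M - A \<Longrightarrow> rk M (A \<union> X) = min (rk M A + card X) (rank M)"
    using A(1) unfolding stressed_iff by blast+
  have S: "S \<subseteq> ground M" "card S = rank M" "rk M A < card (S \<inter> A)"
    using A(2) unfolding cover_def by auto
  have flat: "flat M F" and FE: "F \<subseteq> ground M"
    and nocoloop: "\<And>X. X \<subseteq> F \<Longrightarrow> rk M X + card (F - X) \<le> rk M F \<Longrightarrow> X = F"
    using F(1) unfolding cyclic_flat_def flat_def by blast+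
  have fin: "finite A" "finite S" "finite F"
    by (simp_all add: finite_subset_ground AE FE S(1))
  have submod: "rk M (A \<union> F) + rk M (A \<inter> F) \<le> rk M A + rk M F" by (rule rk_submodular)
  have F_card: "rk M F < card F" using F(2) card_mono[of F "S \<inter> F"] fin by auto
  show ?thesis
  proof (cases "rk M (A \<union> F) = rank M")
    case True
    \<comment> \<open>Both rank bounds are strictly exceeded, while the union has at most
      \<open>rank M\<close> elements, so by submodularity \<open>A \<inter> F\<close> has more
      elements than its rank.\<close>
    have "card (S \<inter> A) + card (S \<inter> F) = card (S \<inter> A \<union> S \<inter> F) + card (S \<inter> A \<inter> (S \<inter> F))"
      using fin by (intro card_Un_Int) auto
    moreover have "card (S \<inter> A \<union> S \<inter> F) \<le> card S" "card (S \<inter> A \<inter> (S \<inter> F)) \<le> card (A \<inter> F)"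
      using fin by (auto intro!: card_mono)
    ultimately have "rk M (A \<inter> F) < card (A \<inter> F)" using submod True S F(2) by linarith
    then have "rk M (A \<inter> F) = rk M A" using sub[of "A \<inter> F"] by simp
    then have "A \<subseteq> F" using flat_spanned_subset[OF flat, of "A \<inter> F" A] AE by simp
    then have "A \<union> F = F" by blast
    then have "rk M F = rank M" using True by simp
    moreover have "card (S \<inter> F) \<le> card S" using fin by (intro card_mono) auto
    ultimately show ?thesis using F(2) S(2) by linarith
  next
    case False
    have "A \<union> (F - A) = A \<union> F" by blast
    then have "rk M (A \<union> F) = min (rk M A + card (F - A)) (rank M)"
      using quot[of "F - A"] FE by auto
    moreover have "card (F - A \<inter> F) = card (F - A)" by (rule arg_cong[of _ _ card]) blast
    ultimately have "rk M (A \<inter> F) + card (F - A \<inter> F) \<le> rk M F"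
      using submod False by linarith
    then have "A \<inter> F = F" by (intro nocoloop) auto
    then have FA: "F \<subseteq> A" by blast
    then have "rk M F = rk M A" using sub[of F] F_card by simp
    then have "A \<subseteq> F" using flat_spanned_subset[OF flat _ FA] AE by simp
    then show ?thesis using FA by blast
  qed
qed

section \<open>Successive relaxations\<close>

text \<open>An independent subset of \<open>X\<close> that comes from a new basis \<open>S\<close>
  lies in \<open>S \<inter> X\<close>, which is too small to raise the rank.\<close>

lemma rk_eq_add_bases:
  assumes "bases N = bases M \<union> C" "\<And>S. S \<in> C \<Longrightarrow> finite S \<and> card (S \<inter> X) \<le> rk M X"
  shows "rk N X = rk M X"
  unfolding rk_def[of N]
proof (rule Max_eqI)
  show le: "y \<le> rk M X" if "y \<in> {card I | I. indep N I \<and> I \<subseteq> X}" for y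
  proof -
    obtain I B where I: "y = card I" "I \<subseteq> X" "I \<subseteq> B" "B \<in> bases M \<or> B \<in> C"
      using \<open>y \<in> _\<close> assms(1) unfolding indep_def by auto
    from I(4) show ?thesis
    proof
      assume "B \<in> bases M"
      then have "indep M I" using I(3) unfolding indep_def by blast
      then show ?thesis using card_le_rk I(1,2) by simp
    next
      assume B: "B \<in> C"
      have "card I \<le> card (B \<inter> X)" using assms(2)[OF B] I(2,3) by (intro card_mono) auto
      then show ?thesis using assms(2)[OF B] I(1) by linarith
    qed
  qed
  then have "{card I | I. indep N I \<and> I \<subseteq> X} \<subseteq> {..rk M X}" by blast
  then show "finite {card I | I. indep N I \<and> I \<subseteq> X}" by (rule finite_subset) simp
  obtain I where I: "indep M I" "I \<subseteq> X" "card I = rk M X" by (rule rk_obtain)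
  have "indep N I" using I(1) assms(1) unfolding indep_def by blast
  then show "rk M X \<in> {card I | I. indep N I \<and> I \<subseteq> X}" using I(2,3) by force
qed

text \<open>The last relaxation is the outermost one of the \<open>foldl\<close>, hence the reversed
  induction. Its cover is formed in \<open>N\<close> but agrees with the cover in \<open>M\<close>,
  because the earlier covers change neither the rank of \<open>A\<close> nor the total rank.\<close>

lemma relax_list_eq:
  assumes "distinct Fs" "\<And>A. A \<in> set Fs \<Longrightarrow> stressed M A"
  shows "relax_list M Fs = \<lparr>ground = ground M, bases = bases M \<union> (\<Union>A \<in> set Fs. cover M A)\<rparr>"
  using assms
proof (induction Fs rule: rev_induct)
  case Nil
  then show ?case by (simp add: relax_list_def)
next
  case (snoc A Fs)
  define N where "N = relax_list M Fs"
  have N: "N = \<lparr>ground = ground M, bases = bases M \<union> (\<Union>A \<in> set Fs. cover M A)\<rparr>"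
    unfolding N_def using snoc by simp
  have bN: "bases N = bases M \<union> (\<Union>A \<in> set Fs. cover M A)" and gN: "ground N = ground M"
    unfolding N by simp_all
  have A: "stressed M A" "A \<notin> set Fs" using snoc.prems by auto
  have fin: "finite S" if "S \<in> cover M B" for S B
    using that unfolding cover_def by (simp add: finite_subset_ground)
  have "rk N A = rk M A"
  proof (rule rk_eq_add_bases[OF bN])
    fix S assume "S \<in> (\<Union>A \<in> set Fs. cover M A)"
    then obtain B where B: "B \<in> set Fs" "S \<in> cover M B" by blast
    \<comment> \<open>Otherwise \<open>S\<close> would lie in the covers of both \<open>A\<close>
      and \<open>B\<close>, which forces \<open>B = A\<close> although \<open>A\<close> is not among
      the earlier sets.\<close>
    have "card (S \<inter> A) \<le> rk M A"
    proof (rule ccontr)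
      assume "\<not> ?thesis"
      then have S: "rk M A < card (S \<inter> A)" by simp
      then have "S \<in> cover M A" using B(2) unfolding cover_def by simp
      then have "cyclic_flat M A" using stressed_cyclic_flat A(1) by blast
      then have "B = A" using cover_cyclic_flat_eq snoc.prems(2) B S by simp
      then show False using B(1) A(2) by blast
    qed
    then show "finite S \<and> card (S \<inter> A) \<le> rk M A" using fin[OF B(2)] by blast
  qed
  moreover have "Defs.rank N = rank M" unfolding gN
  proof (rule rk_eq_add_bases[OF bN])
    fix S assume "S \<in> (\<Union>A \<in> set Fs. cover M A)"
    then obtain B where B: "S \<in> cover M B" by blast
    then have "card (S \<inter> ground M) \<le> rank M"
      using card_mono[OF fin[OF B], of "S \<inter> ground M"] unfolding cover_def by simp
    then show "finite S \<and> card (S \<inter> ground M) \<le> rank M" using fin[OF B] by blast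
  qed
  ultimately have "cover N A = cover M A" unfolding cover_def gN by simp
  then have "relaxation N A =
    \<lparr>ground = ground M, bases = bases M \<union> (\<Union>A \<in> set (Fs @ [A]). cover M A)\<rparr>"
    unfolding relaxation_def gN bN by auto
  then show ?case unfolding N_def relax_list_def by simp
qed

lemma uniform_relax_list_iff:
  assumes "distinct Fs" "set Fs = {A. stressed M A \<and> cover M A \<noteq> {}}"
  shows "uniform_matroid (rank M) (card (ground M)) (relax_list M Fs) \<longleftrightarrow>
    (\<forall>S \<subseteq> ground M. card S = rank M \<longrightarrow> S \<in> bases M \<or> (\<exists>A. stressed M A \<and> S \<in> cover M A))"
proof -
  have "relax_list M Fs = \<lparr>ground = ground M, bases = bases M \<union> (\<Union>A \<in> set Fs. cover M A)\<rparr>"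
    using assms by (intro relax_list_eq) auto
  moreover have "(\<Union>A \<in> set Fs. cover M A) = {S. \<exists>A. stressed M A \<and> S \<in> cover M A}"
    unfolding assms(2) by auto
  moreover have "rank M \<le> card (ground M)" using rk_le_card finite_ground by blast
  ultimately have "uniform_matroid (rank M) (card (ground M)) (relax_list M Fs) \<longleftrightarrow>
    bases M \<union> {S. \<exists>A. stressed M A \<and> S \<in> cover M A} = {S. S \<subseteq> ground M \<and> card S = rank M}"
    unfolding uniform_matroid_def using finite_ground by simp
  moreover have "bases M \<subseteq> {S. S \<subseteq> ground M \<and> card S = rank M}"
    by (simp add: subset_iff card_basis bases_subset[THEN subsetD])
  moreover have "{S. \<exists>A. stressed M A \<and> S \<in> cover M A} \<subseteq> {S. S \<subseteq> ground M \<and> card S = rank M}"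
    unfolding cover_def by blast
  ultimately show ?thesis by blast
qed

section \<open>Matroids with a uniform relaxation\<close>

text \<open>Choose a set \<open>S\<close> of size \<open>rank M\<close> with more than
  \<open>rk M F\<close> elements in \<open>F\<close>. It is no basis, so it lies in the cover of a
  stressed set, which must be \<open>F\<close>.\<close>

lemma cyclic_flat_stressed:
  assumes U: "\<And>S. S \<subseteq> ground M \<Longrightarrow> card S = rank M \<Longrightarrow> S \<in> bases M \<or> (\<exists>A. stressed M A \<and> S \<in> cover M A)"
    and F: "cyclic_flat M F" "F \<noteq> ground M" "rk M F < card F"
  shows "stressed M F"
proof -
  have flat: "F \<subseteq> ground M" "\<And>e. e \<in> ground M - F \<Longrightarrow> rk M F < rk M (insert e F)"
    using F(1) unfolding cyclic_flat_def flat_def by blast+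
  obtain e where e: "e \<in> ground M - F" using flat(1) F(2) by blast
  \<comment> \<open>As \<open>F\<close> is a proper flat, \<open>rk M F + 1\<close> elements of it
    still fit into a set of size \<open>rank M\<close>.\<close>
  have "rk M (insert e F) \<le> rank M" using e flat(1) by (intro rk_mono) auto
  then have less: "rk M F + 1 \<le> rank M" using flat(2)[OF e] by linarith
  have "rk M F + 1 \<le> card F" using F(3) by simp
  then obtain T where T: "T \<subseteq> F" "card T = rk M F + 1"
    by (rule obtain_subset_with_card_n)
  have le: "rank M \<le> card (ground M)" by (rule rk_le_card[OF finite_ground])
  have "card T \<le> rank M" "T \<subseteq> ground M" using T(1) flat(1) less unfolding T(2) by blast+
  then obtain S where S: "T \<subseteq> S" "S \<subseteq> ground M" "card S = rank M"
    by (metis exists_subset_between[OF _ le _ finite_ground])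
  have "finite S" using S(2) by (rule finite_subset_ground)
  then have "card T \<le> card (S \<inter> F)" using S(1) T(1) by (intro card_mono) auto
  then have SF: "rk M F < card (S \<inter> F)" using T(2) by linarith
  have "S \<notin> bases M"
  proof
    assume "S \<in> bases M"
    then have "indep M (S \<inter> F)" unfolding indep_def by blast
    then have "card (S \<inter> F) \<le> rk M F" by (rule card_le_rk) simp
    then show False using SF by linarith
  qed
  then obtain A where A: "stressed M A" "S \<in> cover M A" using U[OF S(2,3)] by blast
  then have "A = F" using F(1) SF by (rule cover_cyclic_flat_eq)
  then show ?thesis using A(1) by simp
qed

text \<open>A set \<open>F - X\<close> of coloops would separate the restriction to
  \<open>F\<close>, so connectedness leaves \<open>X = {}\<close> as the only other case, and then
  \<open>F\<close> would be independent.\<close>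

lemma split_flacet_cyclic_flat:
  assumes "split_flacet M F"
  shows "cyclic_flat M F"
proof -
  have flat: "flat M F" "F \<subseteq> ground M" and c: "connected (restriction M F)" and less: "rk M F < card F"
    using assms unfolding split_flacet_def flacet_def flat_def by blast+
  have "X = F" if X: "X \<subseteq> F" "rk M X + card (F - X) \<le> rk M F" for X
  proof -
    have "finite (F - X)" using flat(2) finite_subset_ground by blast
    then have "rk M (F - X) \<le> card (F - X)" by (rule rk_le_card)
    moreover have "X \<union> (F - X) = F" using X(1) by blast
    then have "rk M F \<le> rk M X + rk M (F - X)" using rk_Un_le[of X "F - X"] by simp
    ultimately have "rk M X + rk M (F - X) = rk M F" using X(2) by linarith
    then have "X = {} \<or> X = F" using c X(1) unfolding connected_restriction_iff[OF flat(2)] by blast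
    moreover have "X \<noteq> {}" using X(2) less by auto
    ultimately show ?thesis by blast
  qed
  then show ?thesis using flat(1) unfolding cyclic_flat_def by blast
qed

text \<open>Contracting a separator is the same as restricting to its complement, so the uniform
  contraction yields the second summand.\<close>

lemma stressed_separator_uniform_sum:
  assumes "stressed M F" "rk M F + rk M (ground M - F) = rank M"
  shows "\<exists>M1 M2. is_uniform M1 \<and> is_uniform M2 \<and> ground M1 \<inter> ground M2 = {} \<and> M = direct_sum M1 M2"
proof (intro exI conjI)
  let ?Q = "ground M - F"
  have F: "F \<subseteq> ground M" and quot: "\<And>X. X \<subseteq> ?Q \<Longrightarrow> rk M (F \<union> X) = min (rk M F + card X) (rank M)"
    using assms(1) unfolding stressed_iff by blast+
  show "is_uniform (restriction M F)" using assms(1) unfolding stressed_def by blast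
  have "rk M X = min (card X) (rk M ?Q)" if X: "X \<subseteq> ?Q" for X
    using quot[OF X] rk_Un_disjoint_separator[OF F assms(2) X] assms(2) by linarith
  then show "is_uniform (restriction M ?Q)"
    unfolding is_uniform_restriction_iff[OF Diff_subset] by blast
  show "ground (restriction M F) \<inter> ground (restriction M ?Q) = {}" by auto
  show "M = direct_sum (restriction M F) (restriction M ?Q)"
    by (rule separator_direct_sum[OF F assms(2)])
qed

text \<open>The ground set is a separator with empty complement, so a uniform matroid is a direct
  sum whose second summand lives on the empty set.\<close>

lemma stressed_ground_uniform_sum:
  assumes "\<And>X. X \<subseteq> ground M \<Longrightarrow> rk M X = min (card X) (rank M)"
  shows "\<exists>M1 M2. is_uniform M1 \<and> is_uniform M2 \<and> ground M1 \<inter> ground M2 = {} \<and> M = direct_sum M1 M2"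
proof (rule stressed_separator_uniform_sum)
  show "stressed M (ground M)" unfolding stressed_iff
  proof (intro conjI allI impI)
    show "rk M X = min (card X) (rank M)" if "X \<subseteq> ground M" for X using that by (rule assms)
  qed simp_all
  show "rk M (ground M) + rk M (ground M - ground M) = rank M" by (simp add: rk_empty)
qed

text \<open>The witness is \<open>P\<close> without the coloops of its restriction.\<close>

lemma separator_cyclic_flat_obtain:
  assumes loopless: "\<And>e. e \<in> ground M \<Longrightarrow> 0 < rk M {e}"
    and P: "P \<subseteq> ground M" "rk M P + rk M (ground M - P) = rank M" "rk M P < card P"
  obtains F where "F \<subseteq> P" "cyclic_flat M F" "rk M F < card F" "rk M F + rk M (ground M - F) = rank M"
proof -
  have finP: "finite P" using P(1) by (rule finite_subset_ground)
  \<comment> \<open>\<open>Q X\<close> says that the elements of \<open>P - X\<close> are coloops of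
    the restriction to \<open>P\<close>; a smallest such \<open>X\<close> has lost all of
    them.\<close>
  define Q where "Q X \<longleftrightarrow> X \<subseteq> P \<and> rk M X + card (P - X) \<le> rk M P" for X
  have "Q P" unfolding Q_def by simp
  then obtain F where QF: "Q F" and min: "\<And>X. Q X \<Longrightarrow> card F \<le> card X"
    using ex_has_least_nat[of Q P card] by blast
  have F: "F \<subseteq> P" "rk M F + card (P - F) \<le> rk M P" using QF unfolding Q_def by auto
  have finF: "finite F" using F(1) finP finite_subset by blast
  have FE: "F \<subseteq> ground M" using F(1) P(1) by blast
  have cardP: "card F + card (P - F) = card P"
    using F(1) finP finF by (simp add: card_Diff_subset card_mono)
  \<comment> \<open>Moving \<open>P - F\<close> to the other side raises the rank there by at most
    \<open>card (P - F)\<close>, which is no more than the first side loses, so the partition stays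
    rank-additive.\<close>
  have "rk M (ground M - F) \<le> rk M (ground M - P) + rk M (P - F)"
  proof -
    have "ground M - F = (ground M - P) \<union> (P - F)" using F(1) P(1) by blast
    then show ?thesis using rk_Un_le[of "ground M - P" "P - F"] by simp
  qed
  moreover have "rk M (P - F) \<le> card (P - F)" using finP by (intro rk_le_card) simp
  moreover have "F \<union> (ground M - F) = ground M" using FE by blast
  then have "rank M \<le> rk M F + rk M (ground M - F)" using rk_Un_le[of F "ground M - F"] by simp
  ultimately have sep: "rk M F + rk M (ground M - F) = rank M" using F(2) P(2) by linarith
  have "rk M F < rk M (insert e F)" if e: "e \<in> ground M - F" for e
    using rk_Un_disjoint_separator[OF FE sep, of "{e}"] loopless[of e] e by simp
  moreover have "X = F" if X: "X \<subseteq> F" "rk M X + card (F - X) \<le> rk M F" for X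
  proof -
    \<comment> \<open>Coloops of the restriction to \<open>F\<close> could be removed from
      \<open>P\<close> as well, so minimality excludes them.\<close>
    have "P - X = (P - F) \<union> (F - X)" using X(1) F(1) by blast
    then have "card (P - X) \<le> card (P - F) + card (F - X)" using card_Un_le by metis
    then have "Q X" unfolding Q_def using X F by auto
    then show ?thesis using min[of X] X(1) finF card_seteq by blast
  qed
  ultimately have "cyclic_flat M F" unfolding cyclic_flat_def flat_def using FE by blast
  moreover have "rk M F < card F" using F(2) P(3) cardP by linarith
  ultimately show thesis using that F(1) sep by blast
qed

lemma rk_loops:
  assumes "\<And>e. e \<in> L \<Longrightarrow> rk M {e} = 0"
  shows "rk M L = 0"
proof -
  obtain I where I: "indep M I" "I \<subseteq> L" "card I = rk M L" by (rule rk_obtain)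
  have "I = {}"
  proof (rule ccontr)
    assume "I \<noteq> {}"
    then obtain e where e: "e \<in> I" by blast
    then have "indep M {e}" using indep_subset[OF I(1)] by simp
    then have "rk M {e} = 1" using rk_indep by fastforce
    then show False using assms[of e] e I(2) by auto
  qed
  then show ?thesis using I(3) by simp
qed

text \<open>Loops, if any, form a cyclic flat of rank 0 that is a separator. Without loops, a
  separator with a dependent side yields a cyclic flat that is again a separator. This flat is
  proper, hence stressed, unless all elements are loops; in that case, or if both sides are
  independent, the matroid itself is uniform.\<close>

lemma disconnected_uniform_sum:
  assumes U: "\<And>S. S \<subseteq> ground M \<Longrightarrow> card S = rank M \<Longrightarrow> S \<in> bases M \<or> (\<exists>A. stressed M A \<and> S \<in> cover M A)"
    and dis: "\<not> connected M"
  shows "\<exists>M1 M2. is_uniform M1 \<and> is_uniform M2 \<and> ground M1 \<inter> ground M2 = {} \<and> M = direct_sum M1 M2"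
proof -
  define L where "L = {e \<in> ground M. rk M {e} = 0}"
  have L: "L \<subseteq> ground M" "rk M L = 0" unfolding L_def by (auto intro: rk_loops)
  show ?thesis
  proof (cases "L = {}")
    case True
    then have loopless: "\<And>e. e \<in> ground M \<Longrightarrow> 0 < rk M {e}" unfolding L_def by auto
    have use_sep: ?thesis if P: "P \<subseteq> ground M" "rk M P + rk M (ground M - P) = rank M"
      "rk M P < card P" "P \<noteq> ground M" for P
    proof -
      obtain F where F: "F \<subseteq> P" "cyclic_flat M F" "rk M F < card F"
        "rk M F + rk M (ground M - F) = rank M"
        by (rule separator_cyclic_flat_obtain[OF loopless P(1-3)])
      have "F \<noteq> ground M" using F(1) P(1,4) by blast
      then have "stressed M F" using cyclic_flat_stressed[OF U F(2)] F(3) by blast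
      then show ?thesis using F(4) by (rule stressed_separator_uniform_sum)
    qed
    obtain P where P: "P \<subseteq> ground M" "rk M P + rk M (ground M - P) = rank M" "P \<noteq> {}" "P \<noteq> ground M"
      using dis unfolding connected_iff by blast
    define P' where "P' = ground M - P"
    have P': "P' \<subseteq> ground M" "ground M - P' = P" "P' \<noteq> ground M"
      unfolding P'_def using P by blast+
    show ?thesis
    proof (cases "rk M P < card P \<or> rk M P' < card P'")
      case True
      then show ?thesis
      proof
        assume "rk M P < card P"
        then show ?thesis using use_sep[OF P(1,2) _ P(4)] by blast
      next
        assume less: "rk M P' < card P'"
        have "rk M P' + rk M (ground M - P') = rank M" unfolding P'(2) using P(2) P'_def by simp
        then show ?thesis using use_sep[OF P'(1) _ less P'(3)] by blast
      qed
    next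
      case False
      have "card P + card P' = card (ground M)"
        unfolding P'_def using P(1) finite_ground finite_subset_ground[OF P(1)]
        by (simp add: card_Diff_subset card_mono)
      then have "card (ground M) \<le> rank M" using False P(2) unfolding P'_def by linarith
      then have rank: "rank M = card (ground M)"
        using rk_le_card[OF finite_ground] by linarith
      then have ind: "indep M (ground M)" by (simp add: indep_iff_rk finite_ground)
      show ?thesis
      proof (rule stressed_ground_uniform_sum)
        fix X assume X: "X \<subseteq> ground M"
        then have "rk M X = card X" by (intro rk_indep indep_subset[OF ind])
        moreover have "card X \<le> rank M" unfolding rank using X by (rule card_mono[OF finite_ground])
        ultimately show "rk M X = min (card X) (rank M)" by simp
      qed
    qed
  next
    case False
    show ?thesis
    proof (cases "L = ground M")
      case True
      show ?thesis
      proof (rule stressed_ground_uniform_sum)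
        fix X assume "X \<subseteq> ground M"
        then have "rk M X \<le> rank M" by (rule rk_mono)
        then show "rk M X = min (card X) (rank M)" using True L(2) by simp
      qed
    next
      case LE: False
      have finL: "finite L" using L(1) by (rule finite_subset_ground)
      have "rk M L < rk M (insert e L)" if e: "e \<in> ground M - L" for e
      proof -
        have "0 < rk M {e}" using e unfolding L_def by auto
        also have "\<dots> \<le> rk M (insert e L)" by (rule rk_mono) simp
        finally show ?thesis using L(2) by simp
      qed
      moreover have "X = L" if "X \<subseteq> L" "rk M X + card (L - X) \<le> rk M L" for X
        using that L(2) finL by auto
      ultimately have "cyclic_flat M L" unfolding cyclic_flat_def flat_def using L(1) by blast
      moreover have "rk M L < card L" using L(2) finL False by (simp add: card_gt_0_iff)
      ultimately have "stressed M L" using cyclic_flat_stressed[OF U _ LE] by blast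
      moreover have "L \<union> (ground M - L) = ground M" using L(1) by blast
      then have "rank M \<le> rk M L + rk M (ground M - L)" using rk_Un_le[of L "ground M - L"] by simp
      moreover have "rk M (ground M - L) \<le> rank M" by (rule rk_mono) simp
      ultimately show ?thesis using L(2) by (intro stressed_separator_uniform_sum) auto
    qed
  qed
qed

lemma relaxed_uniform_imp_elementary_split:
  assumes U: "\<And>S. S \<subseteq> ground M \<Longrightarrow> card S = rank M \<Longrightarrow> S \<in> bases M \<or> (\<exists>A. stressed M A \<and> S \<in> cover M A)"
  shows "elementary_split M"
proof (cases "connected M")
  case True
  have "stressed M F" if F: "split_flacet M F" for F
  proof -
    \<comment> \<open>The element outside a split flacet that is not a coloop makes it a proper
      subset.\<close>
    have "F \<noteq> ground M" "rk M F < card F" using F unfolding split_flacet_def by blast+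
    then show ?thesis using cyclic_flat_stressed[OF U split_flacet_cyclic_flat[OF F]] by blast
  qed
  then show ?thesis using True unfolding elementary_split_def connected_split_def by blast
next
  case False
  then show ?thesis using disconnected_uniform_sum[OF U] unfolding elementary_split_def by blast
qed

section \<open>Nonbases of elementary split matroids\<close>

text \<open>The rank equation says that \<open>G\<close> separates the contraction by
  \<open>H\<close>. A separator of the restriction to \<open>H \<union> G\<close> cannot cut
  \<open>H\<close>, so one of its sides avoids \<open>H\<close>; by submodularity that side is a
  separator of \<open>M\<close>, hence empty.\<close>

lemma connected_restriction_Un:
  assumes "connected M" "connected (restriction M H)" "H \<subseteq> ground M" "H \<noteq> {}" "G \<subseteq> ground M - H"
    and G: "rk M (H \<union> G) + rk M (ground M - G) = rank M + rk M H"
  shows "connected (restriction M (H \<union> G))"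
proof -
  let ?A = "H \<union> G"
  have AE: "?A \<subseteq> ground M" using assms(3,5) by blast
  have disj: "P = {}" if P: "P \<subseteq> ?A" "rk M P + rk M (?A - P) = rk M ?A" "P \<inter> H = {}" for P
  proof -
    have "(?A - P) \<union> (ground M - G) = ground M - P" "(?A - P) \<inter> (ground M - G) = H"
      using P(1,3) assms(3,5) by auto
    then have "rk M (ground M - P) + rk M H \<le> rk M (?A - P) + rk M (ground M - G)"
      using rk_submodular[of "?A - P" "ground M - G"] by simp
    moreover have PE: "P \<subseteq> ground M" using P(1) AE by blast
    then have "P \<union> (ground M - P) = ground M" by blast
    then have "rank M \<le> rk M P + rk M (ground M - P)" using rk_Un_le[of P "ground M - P"] by simp
    ultimately have "rk M P + rk M (ground M - P) = rank M" using P(2) G by linarith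
    then have "P = {} \<or> P = ground M" using assms(1) PE unfolding connected_iff by blast
    then show ?thesis using P(3) assms(3,4) by blast
  qed
  have "P = {} \<or> P = ?A" if P: "P \<subseteq> ?A" "rk M P + rk M (?A - P) = rk M ?A" for P
  proof -
    have "rk M (P \<inter> H) + rk M (H - P) = rk M H" by (rule separator_Int[OF P]) simp
    moreover have "H - P \<inter> H = H - P" by blast
    ultimately have "rk M (P \<inter> H) + rk M (H - P \<inter> H) = rk M H" by simp
    then have "P \<inter> H = {} \<or> P \<inter> H = H"
      using assms(2) unfolding connected_restriction_iff[OF assms(3)] by blast
    then show ?thesis
    proof
      assume "P \<inter> H = {}"
      then show ?thesis using disj[OF P] by blast
    next
      assume "P \<inter> H = H"
      then have int: "(?A - P) \<inter> H = {}" by blast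
      have eq: "?A - (?A - P) = P" using P(1) by blast
      have "rk M (?A - P) + rk M (?A - (?A - P)) = rk M ?A" unfolding eq using P(2) by linarith
      then have "?A - P = {}" using int by (rule disj[OF Diff_subset])
      then show ?thesis using P(1) by blast
    qed
  qed
  then show ?thesis unfolding connected_restriction_iff[OF AE] by blast
qed

text \<open>A loop is a separator by itself. The condition on the ground set excludes the matroid
  that consists of a single loop, which is connected.\<close>

lemma connected_loopless:
  assumes "connected M" "e \<in> ground M" "ground M \<noteq> {e}"
  shows "0 < rk M {e}"
proof (rule ccontr)
  assume "\<not> ?thesis"
  then have 0: "rk M {e} = 0" by simp
  have "{e} \<union> (ground M - {e}) = ground M" using assms(2) by blast
  then have "rank M \<le> rk M {e} + rk M (ground M - {e})" using rk_Un_le[of "{e}" "ground M - {e}"] by simp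
  moreover have "rk M (ground M - {e}) \<le> rank M" by (rule rk_mono) simp
  ultimately have "rk M {e} + rk M (ground M - {e}) = rank M" using 0 by linarith
  then have "{e} = {} \<or> {e} = ground M" using assms(1,2) unfolding connected_iff by blast
  then show False using assms(3) by blast
qed

text \<open>Every basis contains a coloop, so deleting it lowers the rank, which makes it a
  one-element separator.\<close>

lemma connected_not_coloop:
  assumes "connected M" "e \<in> ground M" "ground M \<noteq> {e}"
  shows "\<not> coloop M e"
proof
  assume c: "coloop M e"
  obtain I where I: "indep M I" "I \<subseteq> ground M - {e}" "card I = rk M (ground M - {e})" by (rule rk_obtain)
  have "card I \<noteq> rank M"
  proof
    assume "card I = rank M"
    then have "I \<in> bases M" using I(1) by (simp add: basis_iff)
    then show False using c I(2) unfolding coloop_def by blast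
  qed
  moreover have "rk M (ground M - {e}) \<le> rank M" by (rule rk_mono) simp
  ultimately have less: "rk M (ground M - {e}) < rank M" using I(3) by linarith
  have "rk M {e} \<le> 1" using rk_le_card[of "{e}"] by simp
  moreover have "{e} \<union> (ground M - {e}) = ground M" using assms(2) by blast
  then have "rank M \<le> rk M {e} + rk M (ground M - {e})" using rk_Un_le[of "{e}" "ground M - {e}"] by simp
  ultimately have "rk M {e} + rk M (ground M - {e}) = rank M" using less by linarith
  then have "{e} = {} \<or> {e} = ground M" using assms(1,2) unfolding connected_iff by blast
  then show False using assms(3) by blast
qed

text \<open>Among the sets that violate the rank bound, one of minimal size has a connected restriction.
  Among those with a connected restriction, one of maximal size also has a connected contraction.\<close>

lemma nonbasis_split_flacet_obtain:
  assumes c: "connected M" and S: "S \<subseteq> ground M" "card S = rank M" "S \<notin> bases M"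
  obtains H where "split_flacet M H" "rk M H < card (S \<inter> H)"
proof -
  have finS: "finite S" using S(1) by (rule finite_subset_ground)
  define V where "V H \<longleftrightarrow> H \<subseteq> ground M \<and> rk M H < card (S \<inter> H)" for H
  have split: "V P \<or> V Q" if "P \<subseteq> ground M" "Q \<subseteq> ground M"
    "rk M P + rk M Q < card (S \<inter> P) + card (S \<inter> Q)" for P Q
    using that unfolding V_def by linarith
  have "rk M S < card S"
    using S finS rk_le_card[OF finS] by (auto simp: basis_iff indep_iff_rk)
  then have "V S" unfolding V_def using S(1) by simp
  then obtain F where VF: "V F" and minF: "\<And>X. V X \<Longrightarrow> card F \<le> card X"
    using ex_has_least_nat[of V S card] by blast
  have FE: "F \<subseteq> ground M" and F: "rk M F < card (S \<inter> F)" using VF unfolding V_def by auto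
  have finF: "finite F" using FE by (rule finite_subset_ground)
  \<comment> \<open>Both the rank and the size of the trace of \<open>S\<close> are additive over
    the partition, so one side inherits the violation, and minimality makes it all of
    \<open>F\<close>.\<close>
  have "P = {} \<or> P = F" if P: "P \<subseteq> F" "rk M P + rk M (F - P) = rk M F" for P
  proof -
    have "card (S \<inter> F) = card (S \<inter> P) + card (S \<inter> (F - P))"
      using finS P(1) by (subst card_Un_disjoint[symmetric]) (auto intro!: arg_cong[of _ _ card])
    then have "V P \<or> V (F - P)" using P FE F by (intro split) auto
    then show ?thesis
    proof
      assume "V P"
      then have "P = F" using minF[of P] P(1) finF card_seteq by blast
      then show ?thesis by simp
    next
      assume "V (F - P)"
      then have "F - P = F" using minF[of "F - P"] finF by (intro card_seteq) auto
      then show ?thesis using P(1) by blast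
    qed
  qed
  then have "connected (restriction M F)" unfolding connected_restriction_iff[OF FE] by blast
  then obtain H where H: "V H" "connected (restriction M H)"
    and max: "\<And>X. V X \<Longrightarrow> connected (restriction M X) \<Longrightarrow> card (ground M - H) \<le> card (ground M - X)"
    using ex_has_least_nat[of "\<lambda>X. V X \<and> connected (restriction M X)" F "\<lambda>X. card (ground M - X)"] VF
    by blast
  have HE: "H \<subseteq> ground M" and rH: "rk M H < card (S \<inter> H)" using H(1) unfolding V_def by auto
  have SH: "card (S \<inter> H) \<le> card S" using finS by (intro card_mono) auto
  have H0: "H \<noteq> {}" using rH by auto
  have less: "rk M H < rank M" using rH SH S(2) by linarith
  then have HneE: "H \<noteq> ground M" by auto
  then obtain e where e: "e \<in> ground M" "e \<notin> H" using HE by blast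
  \<comment> \<open>Excludes the connected matroids on one element, which may be a loop or a coloop:
    \<open>H\<close> is both nonempty and proper.\<close>
  have single: "ground M \<noteq> {x}" for x
  proof
    assume "ground M = {x}"
    then show False using e H0 HE by auto
  qed
  \<comment> \<open>Adjoining a separator of the contraction keeps the restriction connected, so by
    maximality of \<open>H\<close> the violation must be lost.\<close>
  have step: "\<not> V (H \<union> G)" if G: "G \<subseteq> ground M - H" "G \<noteq> {}"
    "rk M (H \<union> G) + rk M (ground M - G) = rank M + rk M H" for G
  proof
    assume V: "V (H \<union> G)"
    have "connected (restriction M (H \<union> G))"
      by (rule connected_restriction_Un[OF c H(2) HE H0 G(1,3)])
    then have "card (ground M - H) \<le> card (ground M - (H \<union> G))" using max V by blast
    moreover have "ground M - (H \<union> G) \<subset> ground M - H" using G(1,2) by blast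
    then have "card (ground M - (H \<union> G)) < card (ground M - H)"
      using finite_ground by (intro psubset_card_mono) auto
    ultimately show False by linarith
  qed
  have contr: "P = {} \<or> P = ground M - H"
    if P: "P \<subseteq> ground M - H" "rk M (H \<union> P) + rk M (ground M - P) = rank M + rk M H" for P
  proof (rule ccontr)
    assume ne: "\<not> ?thesis"
    define P' where "P' = ground M - H - P"
    have P': "P' \<subseteq> ground M - H" "P' \<noteq> {}" "H \<union> P' = ground M - P" "ground M - P' = H \<union> P"
      unfolding P'_def using P(1) ne HE by blast+
    \<comment> \<open>The two traces of \<open>S\<close> have union \<open>S\<close> and
      intersection \<open>S \<inter> H\<close>, so their sizes add up to more than
      \<open>rank M + rk M H\<close>. This is the sum of the two ranks, so one of the bounds is
      violated, contrary to \<open>step\<close>.\<close>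
    have "card (S \<inter> (H \<union> P)) + card (S \<inter> (H \<union> P')) = card (S \<inter> (H \<union> P) \<union> S \<inter> (H \<union> P')) +
        card (S \<inter> (H \<union> P) \<inter> (S \<inter> (H \<union> P')))"
      using finS by (intro card_Un_Int) auto
    also have "S \<inter> (H \<union> P) \<union> S \<inter> (H \<union> P') = S" using S(1) P'(3) by blast
    also have "S \<inter> (H \<union> P) \<inter> (S \<inter> (H \<union> P')) = S \<inter> H" unfolding P'_def by blast
    finally have "V (H \<union> P) \<or> V (H \<union> P')"
      using P P' HE rH S(2) by (intro split) auto
    moreover have "\<not> V (H \<union> P)" using step[OF P(1) _ P(2)] ne by blast
    moreover have "\<not> V (H \<union> P')" using P(2) by (intro step P'(1,2)) (simp add: P'(3,4))
    ultimately show False by blast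
  qed
  \<comment> \<open>An element outside \<open>H\<close> that does not raise the rank is a loop of
    the connected contraction, hence its only element, and then \<open>H\<close> would have full
    rank.\<close>
  have "rk M H < rk M (insert x H)" if x: "x \<in> ground M - H" for x
  proof (rule ccontr)
    assume "\<not> ?thesis"
    moreover have "rk M H \<le> rk M (insert x H)" by (rule rk_mono) auto
    ultimately have eq: "rk M H = rk M (insert x H)" by linarith
    have "H \<union> (ground M - {x}) = ground M - {x}" "insert x H \<union> (ground M - {x}) = ground M"
      using x HE by auto
    then have "rk M (ground M - {x}) = rank M"
      using rk_Un_spanning[OF subset_insertI eq, of "ground M - {x}"] by simp
    then have "{x} = {} \<or> {x} = ground M - H" using x eq by (intro contr) auto
    then have "insert x H = ground M" using HE by blast
    then show False using eq less by simp
  qed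
  then have "flat M H" unfolding flat_def using HE by blast
  moreover have "connected (contraction M H)"
    unfolding connected_contraction_iff[OF HE] using contr by blast
  moreover have "0 < rk M H"
  proof -
    obtain x where x: "x \<in> H" using H0 by blast
    then have "0 < rk M {x}" using connected_loopless[OF c] single HE by blast
    also have "\<dots> \<le> rk M H" using x by (intro rk_mono) auto
    finally show ?thesis .
  qed
  moreover have "card (S \<inter> H) \<le> card H" using finite_subset_ground[OF HE] by (intro card_mono) auto
  then have "rk M H < card H" using rH by linarith
  moreover have "\<not> coloop M e" using connected_not_coloop[OF c e(1) single] .
  ultimately have "split_flacet M H"
    unfolding split_flacet_def flacet_def using H(2) e by blast
  then show thesis using that rH by blast
qed

end

section \<open>Direct sums of two uniform matroids\<close>

lemma is_uniform_matroid:
  assumes "is_uniform M"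
  shows "matroid M"
proof -
  obtain k where k: "finite (ground M)" "k \<le> card (ground M)" "bases M = {S. S \<subseteq> ground M \<and> card S = k}"
    using assms unfolding is_uniform_def uniform_matroid_def by blast
  show ?thesis
  proof
    show "finite (ground M)" by (rule k(1))
    show "B \<subseteq> ground M" if "B \<in> bases M" for B using that k(3) by simp
    obtain S where "S \<subseteq> ground M" "card S = k" using k(2) by (meson obtain_subset_with_card_n)
    then show "bases M \<noteq> {}" using k(3) by blast
    show "\<exists>y \<in> B' - B. insert y (B - {x}) \<in> bases M"
      if B: "B \<in> bases M" "B' \<in> bases M" "x \<in> B - B'" for B B' x
    proof -
      have *: "B \<subseteq> ground M" "card B = k" "B' \<subseteq> ground M" "card B' = k" using B(1,2) k(3) by auto
      have fin: "finite B" "finite B'" using * k(1) by (auto intro: finite_subset)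
      have "\<not> B' \<subseteq> B"
      proof
        assume "B' \<subseteq> B"
        then have "B' = B" using fin * by (intro card_subset_eq) auto
        then show False using B(3) by blast
      qed
      then obtain y where y: "y \<in> B' - B" by blast
      have "card (insert y (B - {x})) = Suc (card (B - {x}))" using y fin by simp
      also have "\<dots> = card B" using B(3) fin by (intro card_Suc_Diff1) auto
      finally have "insert y (B - {x}) \<in> bases M" using * y k(3) by auto
      then show ?thesis using y by blast
    qed
  qed
qed

context matroid
begin

text \<open>Rank is additive across a separator, so contracting \<open>P\<close> amounts to
  restricting to its complement, where \<open>u2\<close> applies.\<close>

lemma uniform_separator_stressed:
  assumes P: "P \<subseteq> ground M" "rk M P + rk M (ground M - P) = rank M"
    and u1: "\<And>X. X \<subseteq> P \<Longrightarrow> rk M X = min (card X) (rk M P)"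
    and u2: "\<And>X. X \<subseteq> ground M - P \<Longrightarrow> rk M X = min (card X) (rk M (ground M - P))"
  shows "stressed M P"
proof -
  have "rk M (P \<union> X) = min (rk M P + card X) (rank M)" if X: "X \<subseteq> ground M - P" for X
    using rk_Un_disjoint_separator[OF P X] u2[OF X] P(2) by linarith
  then show ?thesis unfolding stressed_iff using P(1) u1 by blast
qed

text \<open>Both ground sets are stressed. A set of size \<open>rank M\<close> that exceeds the rank
  on neither side attains it on both and would be a basis, so a nonbasis lies in one of the two
  covers.\<close>

lemma uniform_sum_nonbasis_cover:
  assumes u: "is_uniform M1" "is_uniform M2" "ground M1 \<inter> ground M2 = {}" "M = direct_sum M1 M2"
    and S: "S \<subseteq> ground M" "card S = rank M" "S \<notin> bases M"
  shows "\<exists>A. stressed M A \<and> S \<in> cover M A"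
proof -
  define P Q where "P = ground M1" and "Q = ground M2"
  have m: "matroid M1" "matroid M2" using u is_uniform_matroid by blast+
  have PE: "P \<subseteq> ground M" and QE: "Q \<subseteq> ground M" and Q: "ground M - P = Q" and P: "ground M - Q = P"
    using u(3) unfolding u(4) P_def Q_def direct_sum_def by auto
  have sep: "rk M P + rk M Q = rank M"
    using direct_sum_separator[OF m u(3,4)] unfolding P_def[symmetric] Q .
  have r1: "rk M X = rk M1 X" if "X \<subseteq> P" for X
    unfolding u(4) by (rule rk_direct_sum[OF m u(3)]) (use that P_def in simp)
  have r2: "rk M X = rk M2 X" if "X \<subseteq> Q" for X
    unfolding u(4) direct_sum_commute[of M1]
    by (rule rk_direct_sum[OF m(2,1)]) (use that u(3) in \<open>auto simp: Q_def\<close>)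
  have u1: "rk M X = min (card X) (rk M P)" if "X \<subseteq> P" for X
    using u(1)[unfolded matroid.is_uniform_iff[OF m(1)], rule_format, of X] that
      r1[OF that] r1[OF subset_refl] unfolding P_def by argo
  have u2: "rk M X = min (card X) (rk M Q)" if "X \<subseteq> Q" for X
    using u(2)[unfolded matroid.is_uniform_iff[OF m(2)], rule_format, of X] that
      r2[OF that] r2[OF subset_refl] unfolding Q_def by argo
  have "stressed M P"
    by (rule uniform_separator_stressed[OF PE sep[folded Q] u1 u2[folded Q]])
  moreover have "stressed M Q"
    by (rule uniform_separator_stressed[OF QE
      sep[unfolded add.commute[of "rk M P"], folded P] u2 u1[folded P]])
  ultimately have st: "stressed M P" "stressed M Q" .
  show ?thesis
  proof (cases "rk M P < card (S \<inter> P) \<or> rk M Q < card (S \<inter> Q)")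
    case True
    then show ?thesis using st S(1,2) unfolding cover_def by auto
  next
    case False
    have finS: "finite S" using S(1) by (rule finite_subset_ground)
    have SPQ: "S \<inter> P \<union> S \<inter> Q = S" using S(1) Q by blast
    have "S \<inter> P \<inter> (S \<inter> Q) = {}" using Q by blast
    then have "card (S \<inter> P) + card (S \<inter> Q) = card S"
      using finS SPQ card_Un_disjoint[of "S \<inter> P" "S \<inter> Q"] by simp
    then have c: "card (S \<inter> P) = rk M P" "card (S \<inter> Q) = rk M Q" using False sep S(2) by linarith+
    then have "rk M (S \<inter> P) = card (S \<inter> P)" "rk M (S \<inter> Q) = card (S \<inter> Q)"
      using u1[of "S \<inter> P"] u2[of "S \<inter> Q"] by simp_all
    then have "indep M (S \<inter> P)" "indep M (S \<inter> Q)" using finS by (simp_all add: indep_iff_rk)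
    then have "S \<inter> P \<in> bases (restriction M P)" "S \<inter> Q \<in> bases (restriction M Q)"
      using c by (simp_all add: basis_restriction_iff)
    then have "S \<inter> P \<union> S \<inter> Q \<in> bases (direct_sum (restriction M P) (restriction M Q))"
      unfolding direct_sum_def by auto
    also have "direct_sum (restriction M P) (restriction M Q) = M"
      using separator_direct_sum[OF PE] sep unfolding Q by simp
    finally show ?thesis using S(3) SPQ by simp
  qed
qed

lemma elementary_split_imp_relaxed_uniform:
  assumes "elementary_split M" and S: "S \<subseteq> ground M" "card S = rank M" "S \<notin> bases M"
  shows "\<exists>A. stressed M A \<and> S \<in> cover M A"
proof -
  consider "connected_split M" | M1 M2 where "is_uniform M1" "is_uniform M2" "ground M1 \<inter> ground M2 = {}"
      "M = direct_sum M1 M2"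
    using assms(1) unfolding elementary_split_def by blast
  then show ?thesis
  proof cases
    case 1
    obtain H where H: "split_flacet M H" "rk M H < card (S \<inter> H)"
      using nonbasis_split_flacet_obtain[OF _ S] 1 unfolding connected_split_def by blast
    then have "stressed M H" using 1 unfolding connected_split_def by blast
    moreover have "S \<in> cover M H" using H(2) S(1,2) unfolding cover_def by simp
    ultimately show ?thesis by blast
  next
    case 2
    then show ?thesis using uniform_sum_nonbasis_cover S by blast
  qed
qed

end

theorem theorem1p2:
  fixes M :: "'a matroid_data" and k n :: nat and Fs :: "'a set list"
  assumes "matroid M"
    and "rank M = k"
    and "card (ground M) = n"
    and "distinct Fs"
    and "set Fs = {A. stressed M A \<and> cover M A \<noteq> {}}"
  shows "elementary_split M \<longleftrightarrow> uniform_matroid k n (relax_list M Fs)"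
proof -
  interpret matroid M by (rule assms(1))
  have "uniform_matroid k n (relax_list M Fs) \<longleftrightarrow>
    (\<forall>S \<subseteq> ground M. card S = rank M \<longrightarrow> S \<in> bases M \<or> (\<exists>A. stressed M A \<and> S \<in> cover M A))"
    using uniform_relax_list_iff[OF assms(4,5)] assms(2,3) by simp
  then show ?thesis
    using relaxed_uniform_imp_elementary_split elementary_split_imp_relaxed_uniform by blast
qed

end
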